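(* Let $N\ge 2$, $\omega\in\mathbb{R}$, $\kappa>0$, and consider, with the delay $\tau>0$ as bifurcation parameter, the unidirectional ring of delay-coupled phase oscillators $$\dot{x}_{j}(t)=\omega+\kappa\sin\left(x_{j+1}(t-\tau)-x_{j}(t)\right),\qquad j=1,\dots,N,\quad x_{N+1}:=x_1 .$$ Let $x_{\tau}(t)=\Omega(\tau)t$ be a branch of synchronous solutions of this system, so that $\Omega=\omega-\kappa\sin(\Omega\tau)$ along the branch, and put $K=\kappa\cos(\Omega\tau)$. Then, as $\tau$ is varied, the branch undergoes a transcritical bifurcation at points where $K=0$. If moreover $\omega\ne\pi l\kappa$ for every odd integer $l$, then the branch undergoes a fold bifurcation at points where $K=-1/\tau$.
   Context: The variables $x_j$ are phases, taken in $\mathbb{R}/2\pi\mathbb{Z}$, and indices are taken modulo $N$. A synchronous solution is a solution with $x_j(t)=\Omega t$ for all $j$, with $\Omega\in\mathbb{R}$; it exists exactly when $\Omega=\omega-\kappa\sin(\Omega\tau)$. A branch of synchronous solutions is a curve of pairs $(\tau,\Omega)$ satisfying this equation. The characteristic exponents of such a solution are the numbers $\mu\in\mathbb{C}$ satisfying $\mu+K-Ke^{-\mu\tau}e^{2\pi i n/N}=0$ for some $n\in\{0,\dots,N-1\}$, equivalently the zeros of $F(\mu)=-(\mu+K)^N+K^Ne^{-N\mu\tau}$; $\mu=0$ is always a characteristic exponent (the trivial one). Terminology for the bifurcations. Both occur at parameter values where $\mu=0$ is a non-simple zero of $F$, with nontrivial characteristic exponents passing through $0$. A fold bifurcation is one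 in which two synchronous solutions emerge (or collide and disappear) at the point as $\tau$ is varied, i.e. a fold (saddle-node) of the solution set of $\Omega=\omega-\kappa\sin(\Omega\tau)$ in the $(\tau,\Omega)$-plane with respect to $\tau$. A transcritical bifurcation here means that, as $\tau$ is varied, the branch of synchronous solutions continues through the point with no other synchronous solution emerging there, while nontrivial characteristic exponents cross the imaginary axis through $0$ with nonzero speed, so that the stability of the branch changes. *)

theory Defs
  imports "HOL-Analysis.Analysis"
begin

text \<open>
  The oscillators are indexed by \<open>0, \<dots>, N - 1\<close>, with \<open>Suc j mod N\<close> the successor of \<open>j\<close> in the
  ring.  Phases are represented by real-valued lifts; the equation is invariant under shifting
  any phase by a multiple of \<open>2\<pi>\<close>.
\<close>

definition ring_solution ::
    "nat \<Rightarrow> real \<Rightarrow> real \<Rightarrow> real \<Rightarrow> (nat \<Rightarrow> real \<Rightarrow> real) \<Rightarrow> bool" where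
  "ring_solution N \<omega> \<kappa> \<tau> x \<longleftrightarrow>
     (\<forall>j<N. \<forall>t. (x j has_real_derivative
        \<omega> + \<kappa> * sin (x (Suc j mod N) (t - \<tau>) - x j t)) (at t))"

definition sync_set :: "nat \<Rightarrow> real \<Rightarrow> real \<Rightarrow> (real \<times> real) set" where
  "sync_set N \<omega> \<kappa> = {(\<tau>, \<Omega>). \<tau> > 0 \<and> ring_solution N \<omega> \<kappa> \<tau> (\<lambda>j t. \<Omega> * t)}"

lemma sync_set_iff:
  assumes "N > 0"
  shows "(\<tau>, \<Omega>) \<in> sync_set N \<omega> \<kappa> \<longleftrightarrow> \<tau> > 0 \<and> \<Omega> = \<omega> - \<kappa> * sin (\<Omega> * \<tau>)"
proof -
  have d: "((\<lambda>t. \<Omega> * t) has_real_derivative \<Omega>) (at t)" for t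
    by (auto intro!: derivative_eq_intros)
  have e: "\<omega> + \<kappa> * sin (\<Omega> * (t - \<tau>) - \<Omega> * t) = \<omega> - \<kappa> * sin (\<Omega> * \<tau>)" for t
    by (simp add: algebra_simps)
  show ?thesis
    unfolding sync_set_def ring_solution_def using assms d DERIV_unique[OF d]
    by (auto simp: e)
qed

text \<open>
  A branch may turn around with respect to \<open>\<tau>\<close>, so it is a curve \<open>s \<mapsto> (\<tau>, \<Omega>)\<close> and not necessarily
  the graph of a function of \<open>\<tau>\<close>.  The parameter interval is open, so that every point of the
  branch is an interior point.
\<close>

definition sync_branch ::
    "nat \<Rightarrow> real \<Rightarrow> real \<Rightarrow> real set \<Rightarrow> (real \<Rightarrow> real \<times> real) \<Rightarrow> bool" where
  "sync_branch N \<omega> \<kappa> S c \<longleftrightarrow>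
     open S \<and> is_interval S \<and> continuous_on S c \<and> inj_on c S \<and> c ` S \<subseteq> sync_set N \<omega> \<kappa>"

definition gain :: "real \<Rightarrow> real \<Rightarrow> real \<Rightarrow> real" where
  "gain \<kappa> \<tau> \<Omega> = \<kappa> * cos (\<Omega> * \<tau>)"

definition char_exponents :: "nat \<Rightarrow> real \<Rightarrow> real \<Rightarrow> real \<Rightarrow> complex set" where
  "char_exponents N \<kappa> \<tau> \<Omega> =
     {\<mu>. \<exists>n<N. \<mu> + of_real (gain \<kappa> \<tau> \<Omega>)
            - of_real (gain \<kappa> \<tau> \<Omega>) * exp (- \<mu> * of_real \<tau>)
                * exp (2 * of_real pi * \<i> * of_nat n / of_nat N) = 0}"

definition char_fun :: "nat \<Rightarrow> real \<Rightarrow> real \<Rightarrow> real \<Rightarrow> complex \<Rightarrow> complex" where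
  "char_fun N \<kappa> \<tau> \<Omega> \<mu> =
     - ((\<mu> + of_real (gain \<kappa> \<tau> \<Omega>)) ^ N)
     + of_real (gain \<kappa> \<tau> \<Omega>) ^ N * exp (- of_nat N * \<mu> * of_real \<tau>)"

definition non_simple_zero :: "(complex \<Rightarrow> complex) \<Rightarrow> complex \<Rightarrow> bool" where
  "non_simple_zero f z \<longleftrightarrow> f z = 0 \<and> deriv f z = 0"

text \<open>
  The trivial exponent \<open>0\<close> is disregarded once, hence it has to be a simple zero for stability.
\<close>

definition sync_stable :: "nat \<Rightarrow> real \<Rightarrow> real \<Rightarrow> real \<Rightarrow> bool" where
  "sync_stable N \<kappa> \<tau> \<Omega> \<longleftrightarrow>
     \<not> non_simple_zero (char_fun N \<kappa> \<tau> \<Omega>) 0 \<and>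
     (\<forall>\<mu>\<in>char_exponents N \<kappa> \<tau> \<Omega>. \<mu> \<noteq> 0 \<longrightarrow> Re \<mu> < 0)"

definition sync_unstable :: "nat \<Rightarrow> real \<Rightarrow> real \<Rightarrow> real \<Rightarrow> bool" where
  "sync_unstable N \<kappa> \<tau> \<Omega> \<longleftrightarrow> (\<exists>\<mu>\<in>char_exponents N \<kappa> \<tau> \<Omega>. Re \<mu> > 0)"

text \<open>
  Along a curve \<open>c\<close> of synchronous solutions, the functions \<open>\<mu> 0, \<dots>, \<mu> (m - 1)\<close> with \<open>m \<ge> 1\<close>
  describe all nontrivial exponents that reach \<open>0\<close> at parameter value \<open>s0\<close>: near \<open>0\<close> there are
  no exponents except these and the trivial one.
\<close>

definition exponents_through_zero ::
    "nat \<Rightarrow> real \<Rightarrow> (real \<Rightarrow> real \<times> real) \<Rightarrow> real \<Rightarrow> nat \<Rightarrow> (nat \<Rightarrow> real \<Rightarrow> complex) \<Rightarrow> bool" where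
  "exponents_through_zero N \<kappa> c s0 m \<mu> \<longleftrightarrow>
     m \<ge> 1 \<and>
     (\<exists>\<epsilon>>0. \<exists>\<delta>>0.
        (\<forall>s\<in>ball s0 \<epsilon>. char_exponents N \<kappa> (fst (c s)) (snd (c s)) \<inter> ball 0 \<delta>
             = insert 0 ((\<lambda>i. \<mu> i s) ` {..<m})) \<and>
        (\<forall>i<m. continuous_on (ball s0 \<epsilon>) (\<mu> i) \<and> \<mu> i s0 = 0 \<and>
           (\<forall>s\<in>ball s0 \<epsilon> - {s0}. \<mu> i s \<noteq> 0)))"

text \<open>
  In both definitions below, \<open>B\<close> is the set of points of the branch.  Within a box around
  \<open>(\<tau>0, \<Omega>0)\<close> it comprises all synchronous solutions.
\<close>

definition transcritical_bifurcation ::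
    "nat \<Rightarrow> real \<Rightarrow> real \<Rightarrow> (real \<times> real) set \<Rightarrow> real \<Rightarrow> real \<Rightarrow> bool" where
  "transcritical_bifurcation N \<omega> \<kappa> B \<tau>0 \<Omega>0 \<longleftrightarrow>
     non_simple_zero (char_fun N \<kappa> \<tau>0 \<Omega>0) 0 \<and>
     (\<exists>\<epsilon>>0. \<exists>\<eta>>0. \<exists>g.
        g \<tau>0 = \<Omega>0 \<and> continuous_on (ball \<tau>0 \<epsilon>) g \<and>
        sync_set N \<omega> \<kappa> \<inter> (ball \<tau>0 \<epsilon> \<times> ball \<Omega>0 \<eta>) = (\<lambda>\<tau>. (\<tau>, g \<tau>)) ` ball \<tau>0 \<epsilon> \<and>
        B \<inter> (ball \<tau>0 \<epsilon> \<times> ball \<Omega>0 \<eta>) = (\<lambda>\<tau>. (\<tau>, g \<tau>)) ` ball \<tau>0 \<epsilon> \<and>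
        (\<exists>m \<mu>. exponents_through_zero N \<kappa> (\<lambda>\<tau>. (\<tau>, g \<tau>)) \<tau>0 m \<mu> \<and>
           (\<forall>i<m. \<exists>v. (\<mu> i has_vector_derivative v) (at \<tau>0) \<and> Re v \<noteq> 0)) \<and>
        ((\<forall>\<tau>\<in>{\<tau>0 - \<epsilon><..<\<tau>0}. sync_stable N \<kappa> \<tau> (g \<tau>)) \<and>
         (\<forall>\<tau>\<in>{\<tau>0<..<\<tau>0 + \<epsilon>}. sync_unstable N \<kappa> \<tau> (g \<tau>)) \<or>
         (\<forall>\<tau>\<in>{\<tau>0 - \<epsilon><..<\<tau>0}. sync_unstable N \<kappa> \<tau> (g \<tau>)) \<and>
         (\<forall>\<tau>\<in>{\<tau>0<..<\<tau>0 + \<epsilon>}. sync_stable N \<kappa> \<tau> (g \<tau>))))"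

text \<open>
  Two solutions \<open>\<Omega>1 d < \<Omega>0 < \<Omega>2 d\<close> at \<open>\<tau> = \<tau>0 + \<sigma> d\<close> merge into \<open>\<Omega>0\<close> at \<open>d = 0\<close>, and none are left
  at \<open>\<tau> = \<tau>0 - \<sigma> d\<close>.  They emerge as \<open>\<tau>\<close> increases if \<open>\<sigma> = 1\<close>; they collide if \<open>\<sigma> = - 1\<close>.
\<close>

definition two_solutions_emerge ::
    "nat \<Rightarrow> real \<Rightarrow> real \<Rightarrow> real \<Rightarrow> real \<Rightarrow> bool" where
  "two_solutions_emerge N \<omega> \<kappa> \<tau>0 \<Omega>0 \<longleftrightarrow>
     (\<exists>\<sigma>\<in>{1, - 1}. \<exists>\<epsilon>>0. \<exists>\<eta>>0. \<exists>\<Omega>1 \<Omega>2.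
        {\<Omega>\<in>ball \<Omega>0 \<eta>. (\<tau>0, \<Omega>) \<in> sync_set N \<omega> \<kappa>} = {\<Omega>0} \<and>
        (\<forall>d\<in>{0<..<\<epsilon>}.
           {\<Omega>\<in>ball \<Omega>0 \<eta>. (\<tau>0 + \<sigma> * d, \<Omega>) \<in> sync_set N \<omega> \<kappa>} = {\<Omega>1 d, \<Omega>2 d} \<and>
           \<Omega>1 d < \<Omega>0 \<and> \<Omega>0 < \<Omega>2 d \<and>
           {\<Omega>\<in>ball \<Omega>0 \<eta>. (\<tau>0 - \<sigma> * d, \<Omega>) \<in> sync_set N \<omega> \<kappa>} = {}) \<and>
        (\<Omega>1 \<longlongrightarrow> \<Omega>0) (at_right 0) \<and> (\<Omega>2 \<longlongrightarrow> \<Omega>0) (at_right 0))"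

text \<open>
  Nontrivial exponents pass through \<open>0\<close> along the branch, parametrized by \<open>\<Omega>\<close> because \<open>\<tau>\<close> is
  not a parameter there; their real parts change sign.
\<close>

definition fold_bifurcation ::
    "nat \<Rightarrow> real \<Rightarrow> real \<Rightarrow> (real \<times> real) set \<Rightarrow> real \<Rightarrow> real \<Rightarrow> bool" where
  "fold_bifurcation N \<omega> \<kappa> B \<tau>0 \<Omega>0 \<longleftrightarrow>
     non_simple_zero (char_fun N \<kappa> \<tau>0 \<Omega>0) 0 \<and>
     two_solutions_emerge N \<omega> \<kappa> \<tau>0 \<Omega>0 \<and>
     (\<exists>\<epsilon>>0. \<exists>\<eta>>0. \<exists>h h' a.
        h \<Omega>0 = \<tau>0 \<and>
        sync_set N \<omega> \<kappa> \<inter> (ball \<tau>0 \<epsilon> \<times> ball \<Omega>0 \<eta>) = (\<lambda>\<Omega>. (h \<Omega>, \<Omega>)) ` ball \<Omega>0 \<eta> \<and>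
        B \<inter> (ball \<tau>0 \<epsilon> \<times> ball \<Omega>0 \<eta>) = (\<lambda>\<Omega>. (h \<Omega>, \<Omega>)) ` ball \<Omega>0 \<eta> \<and>
        (\<forall>\<Omega>\<in>ball \<Omega>0 \<eta>. (h has_real_derivative h' \<Omega>) (at \<Omega>)) \<and>
        h' \<Omega>0 = 0 \<and> (h' has_real_derivative a) (at \<Omega>0) \<and> a \<noteq> 0 \<and>
        (\<exists>m \<mu>. exponents_through_zero N \<kappa> (\<lambda>\<Omega>. (h \<Omega>, \<Omega>)) \<Omega>0 m \<mu> \<and>
           (\<forall>i<m. \<exists>\<sigma>\<in>{1, - 1}. \<forall>\<^sub>F \<Omega> in at \<Omega>0. \<sigma> * (\<Omega> - \<Omega>0) * Re (\<mu> i \<Omega>) > 0)))"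

end

theory Submission
  imports Defs "HOL-Complex_Analysis.Complex_Analysis"
begin

text \<open>
  In the coordinate \<open>\<theta> = \<Omega> \<tau>\<close>, the synchronous solutions with \<open>\<Omega> \<noteq> 0\<close> form the single curve
  \<open>\<theta> \<mapsto> (\<theta> / (\<omega> - \<kappa> sin \<theta>), \<omega> - \<kappa> sin \<theta>)\<close>.  Its first component has derivative \<open>(1 + K\<tau>) / \<Omega>\<close>
  and its second one \<open>- K\<close>; so it is a graph over \<open>\<tau>\<close> near \<open>K = 0\<close> and a graph \<open>\<tau> = h(\<Omega>)\<close> near
  \<open>K = - 1 / \<tau>\<close>, where \<open>h' = - (1 + K\<tau>) / (K\<Omega>)\<close> vanishes and \<open>h'' \<noteq> 0\<close> unless \<open>sin \<theta> = 0\<close>, which is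
  the excluded resonance.

  With \<open>u = \<mu>\<tau>\<close> and \<open>k = K\<tau>\<close>, the exponents for the root of unity \<open>z\<close> solve \<open>u + k = k e\<^sup>-\<^sup>u z\<close>, which can
  be solved for \<open>k\<close>: locally \<open>u\<close> is the inverse of \<open>u \<mapsto> u / (e\<^sup>-\<^sup>u z - 1)\<close>.  At \<open>u = 0\<close> this function
  has the value \<open>0\<close> and the derivative \<open>1 / (z - 1)\<close> if \<open>z \<noteq> 1\<close>, and the value \<open>- 1\<close> and the
  derivative \<open>- 1 / 2\<close> if \<open>z = 1\<close>.  Hence near \<open>k = 0\<close> there are \<open>N - 1\<close> nontrivial exponents
  \<open>\<mu> \<approx> K (z - 1)\<close>, and near \<open>k = - 1\<close> there is exactly one, \<open>\<mu> \<approx> - 2 (1 + K\<tau>) / \<tau>\<close>.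
\<close>

subsection \<open>Local inverses and local graphs\<close>

lemma isCont_eventually:
  assumes "isCont f x0" "\<forall>\<^sub>F y in nhds (f x0). P y"
  shows "\<forall>\<^sub>F x in nhds x0. P (f x)"
  using eventually_compose_filterlim[OF assms(2)] assms(1)
  by (simp add: continuous_at tendsto_at_iff_tendsto_nhds)

text \<open>The type covers both \<open>real\<close>, for the curve of solutions, and
  \<open>complex\<close>, for the exponents. Uniqueness is stated on a neighbourhood of the pair, so
  that it can be pulled back when parameter and root vary together.\<close>

lemma DERIV_local_inverse:
  fixes f f' :: "'a::{euclidean_space, real_normed_field} \<Rightarrow> 'a"
  assumes "open U" "x0 \<in> U"
    and deriv: "\<forall>x\<in>U. (f has_field_derivative f' x) (at x)"
    and cont: "continuous_on U f'" and nz: "f' x0 \<noteq> 0"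
  obtains g where "g (f x0) = x0"
    and "\<forall>\<^sub>F p in nhds (f x0, x0). f (snd p) = fst p \<longleftrightarrow> snd p = g (fst p)"
    and "\<forall>\<^sub>F y in nhds (f x0). f (g y) = y"
    and "\<forall>\<^sub>F y in nhds (f x0). (g has_field_derivative inverse (f' (g y))) (at y)"
proof -
  \<comment> \<open>The inverse function theorem speaks of bounded linear derivatives; a field
    derivative enters as the operator of multiplication by it, which is invertible because
    \<open>f' x0\<close> is nonzero.\<close>
  have inv: "blinfun_mult_right (inverse (f' x0)) o\<^sub>L blinfun_mult_right (f' x0) = id_blinfun"
    using nz by (intro blinfun_eqI) (simp add: blinfun_mult_right.rep_eq)
  have cont': "continuous_on U (\<lambda>x. blinfun_mult_right (f' x))"
    using cont bounded_linear_blinfun_mult_right by (rule bounded_linear.continuous_on[rotated])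
  have deriv': "(f has_derivative blinfun_apply (blinfun_mult_right (f' x))) (at x)"
    if "x \<in> U" for x
    using deriv that by (simp add: has_field_derivative_def blinfun_mult_right.rep_eq)
  obtain U' V g where U': "open U'" "U' \<subseteq> U" "x0 \<in> U'"
    and V: "open V" "f x0 \<in> V" and hom: "homeomorphism U' V f g"
    by (rule inverse_function_theorem[where f = f and f' = "\<lambda>x. blinfun_mult_right (f' x)",
          OF assms(1) deriv' cont' assms(2) inv]) (assumption, rule that)
  show thesis
  proof
    have gf: "g (f x) = x" if "x \<in> U'" for x
      using hom that by (simp add: homeomorphism_def)
    have fg: "f (g y) = y" "g y \<in> U'" if "y \<in> V" for y
      using hom that by (auto simp: homeomorphism_def)
    have contg: "isCont g y" if "y \<in> V" for y
      using hom that V(1) continuous_on_eq_continuous_at by (auto simp: homeomorphism_def)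
    show "g (f x0) = x0"
      using gf U' by simp
    have "open (V \<times> U')" "(f x0, x0) \<in> V \<times> U'"
      using U' V by (auto intro: open_Times)
    then show "\<forall>\<^sub>F p in nhds (f x0, x0). f (snd p) = fst p \<longleftrightarrow> snd p = g (fst p)"
      unfolding eventually_nhds using gf fg by (intro exI[of _ "V \<times> U'"]) auto
    show "\<forall>\<^sub>F y in nhds (f x0). f (g y) = y"
      using V fg eventually_nhds by blast
    \<comment> \<open>The derivative of \<open>g\<close> at \<open>y\<close> is a reciprocal, so
      \<open>f' (g y)\<close> must stay away from 0 for all \<open>y\<close> near
      \<open>f x0\<close>; this follows from continuity.\<close>
    have "isCont (\<lambda>y. f' (g y)) (f x0)"
    proof (rule isCont_o2[where g = f' and f = g])
      show "isCont g (f x0)"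
        using contg V(2) by blast
      show "isCont f' (g (f x0))"
        using cont assms(1,2) gf[OF U'(3)] by (metis continuous_on_eq_continuous_at)
    qed
    from isCont_eventually[OF this, of "\<lambda>y. y \<in> - {0}"]
    have "\<forall>\<^sub>F y in nhds (f x0). f' (g y) \<noteq> 0"
      using nz gf[OF U'(3)] eventually_nhds_in_open[of "- {0}" "f' x0"] by auto
    moreover have "\<forall>\<^sub>F y in nhds (f x0). y \<in> V"
      using V by (simp add: eventually_nhds_in_open)
    ultimately show "\<forall>\<^sub>F y in nhds (f x0). (g has_field_derivative inverse (f' (g y))) (at y)"
    proof eventually_elim
      case (elim y)
      have "continuous_on U' f"
        using hom by (simp add: homeomorphism_def)
      moreover have "(f has_field_derivative f' (g y)) (at (g y))"
        using deriv fg elim(2) U'(2) by blast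
      ultimately show ?case
        using U'(1) fg[OF elim(2)] gf elim(1)
        by (intro has_field_derivative_inverse_strong_x[where S = U' and f = f])
    qed
  qed
qed

lemma DERIV_eventually_sign:
  fixes f :: "real \<Rightarrow> real"
  assumes "(f has_real_derivative d) (at x0)" "f x0 = 0" "d \<noteq> 0"
  shows "\<forall>\<^sub>F x in at x0. d * (x - x0) * f x > 0"
proof -
  have "((\<lambda>x. (f x - f x0) / (x - x0)) \<longlongrightarrow> d) (at x0)"
    using assms(1) by (simp add: has_field_derivative_iff)
  then have "((\<lambda>x. d * ((f x - f x0) / (x - x0))) \<longlongrightarrow> d * d) (at x0)"
    by (intro tendsto_intros)
  moreover have "d * d > 0"
    using assms(3) by (auto simp: zero_less_mult_iff linorder_neq_iff)
  ultimately have "\<forall>\<^sub>F x in at x0. d * ((f x - f x0) / (x - x0)) > 0"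
    by (rule order_tendstoD)
  moreover have "\<forall>\<^sub>F x in at x0. x \<noteq> x0"
    by (simp add: eventually_at_filter)
  ultimately show ?thesis
  proof eventually_elim
    case (elim x)
    then have "(x - x0)\<^sup>2 * (d * (f x / (x - x0))) > 0"
      using assms(2) by (subst zero_less_mult_iff) simp
    also have "(x - x0)\<^sup>2 * (d * (f x / (x - x0))) = d * (x - x0) * f x"
      using elim by (simp add: power2_eq_square)
    finally show ?case .
  qed
qed

text \<open>A property near a pair holds on a product of neighbourhoods. The second factor fixes
  \<open>r\<close> once and for all, while the condition on \<open>x\<close> stays an eventual one
  and can later be combined with further shrinking.\<close>

lemma local_graph:
  fixes P :: "'a::metric_space \<Rightarrow> 'b::metric_space \<Rightarrow> bool"
  assumes ex: "\<forall>\<^sub>F x in nhds x0. P x (g x)"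
    and unique: "\<forall>\<^sub>F p in nhds (x0, g x0). P (fst p) (snd p) \<longrightarrow> snd p = g (fst p)"
    and cont: "isCont g x0"
  obtains r where "r > 0"
    and "\<forall>\<^sub>F x in nhds x0. g x \<in> ball (g x0) r \<and> (\<forall>y\<in>ball (g x0) r. P x y \<longleftrightarrow> y = g x)"
proof -
  obtain Q R where Q: "eventually Q (nhds x0)" and R: "eventually R (nhds (g x0))"
    and QR: "\<And>x y. Q x \<Longrightarrow> R y \<Longrightarrow> P x y \<Longrightarrow> y = g x"
    using unique unfolding nhds_prod eventually_prod_filter by auto
  obtain r where r: "r > 0" "\<And>y. y \<in> ball (g x0) r \<Longrightarrow> R y"
    using R by (auto simp: eventually_nhds_metric dist_commute)
  have "\<forall>\<^sub>F x in nhds x0. g x \<in> ball (g x0) r"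
    using isCont_eventually[OF cont, of "\<lambda>y. y \<in> ball (g x0) r"] r(1)
      eventually_nhds_in_open[of "ball (g x0) r" "g x0"] by simp
  with ex Q have "\<forall>\<^sub>F x in nhds x0.
      g x \<in> ball (g x0) r \<and> (\<forall>y\<in>ball (g x0) r. P x y \<longleftrightarrow> y = g x)"
    by eventually_elim (use r QR in auto)
  with r show thesis
    using that by blast
qed

text \<open>This trades the radii of the definition for filters. First \<delta> is taken from the
  product neighbourhood; then \<epsilon> is made so small that continuity keeps every
  \<open>\<mu> i s\<close> inside \<open>ball 0 \<delta>\<close>, which gives the inclusion of the
  listed exponents in the ball.\<close>

lemma exponents_through_zeroI:
  assumes "m \<ge> 1"
    and zero: "\<And>i. i < m \<Longrightarrow> \<mu> i s0 = 0"
    and cont: "\<And>i. i < m \<Longrightarrow> \<forall>\<^sub>F s in nhds s0. isCont (\<mu> i) s"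
    and nz: "\<And>i. i < m \<Longrightarrow> \<forall>\<^sub>F s in at s0. \<mu> i s \<noteq> 0"
    and exps: "\<forall>\<^sub>F p in nhds (s0, 0).
      snd p \<in> char_exponents N \<kappa> (fst (c (fst p))) (snd (c (fst p))) \<longleftrightarrow>
      snd p \<in> insert 0 ((\<lambda>i. \<mu> i (fst p)) ` {..<m})"
  shows "exponents_through_zero N \<kappa> c s0 m \<mu>"
proof -
  obtain Q R where Q: "eventually Q (nhds s0)" and R: "eventually R (nhds 0)"
    and QR: "\<And>s z. Q s \<Longrightarrow> R z \<Longrightarrow> z \<in> char_exponents N \<kappa> (fst (c s)) (snd (c s)) \<longleftrightarrow>
      z \<in> insert 0 ((\<lambda>i. \<mu> i s) ` {..<m})"
    using exps unfolding nhds_prod eventually_prod_filter by auto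
  obtain \<delta> where \<delta>: "\<delta> > 0" "\<And>z. z \<in> ball 0 \<delta> \<Longrightarrow> R z"
    using R by (auto simp: eventually_nhds_metric dist_commute)
  have "\<forall>\<^sub>F s in nhds s0. \<mu> i s \<in> ball 0 \<delta>" if "i < m" for i
  proof -
    have "isCont (\<mu> i) s0"
      using cont[OF that] eventually_nhds_x_imp_x by auto
    then show ?thesis
      using isCont_eventually[of s0 "\<mu> i" "\<lambda>y. y \<in> ball 0 \<delta>"] \<delta>(1) zero[OF that]
        eventually_nhds_in_open[of "ball 0 \<delta>" "0::complex"] by simp
  qed
  moreover have "\<forall>\<^sub>F s in nhds s0. s \<noteq> s0 \<longrightarrow> \<mu> i s \<noteq> 0" if "i < m" for i
    using nz[OF that] by (simp add: eventually_at_filter)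
  ultimately have "\<forall>\<^sub>F s in nhds s0. \<forall>i\<in>{..<m}.
      isCont (\<mu> i) s \<and> \<mu> i s \<in> ball 0 \<delta> \<and> (s \<noteq> s0 \<longrightarrow> \<mu> i s \<noteq> 0)"
    using cont by (intro eventually_ball_finite finite_lessThan ballI eventually_conj) auto
  with Q have "\<forall>\<^sub>F s in nhds s0. Q s \<and> (\<forall>i\<in>{..<m}.
      isCont (\<mu> i) s \<and> \<mu> i s \<in> ball 0 \<delta> \<and> (s \<noteq> s0 \<longrightarrow> \<mu> i s \<noteq> 0))"
    by (rule eventually_conj)
  then obtain \<epsilon> where \<epsilon>: "\<epsilon> > 0" "\<And>s. s \<in> ball s0 \<epsilon> \<Longrightarrow> Q s"
    "\<And>s i. s \<in> ball s0 \<epsilon> \<Longrightarrow> i < m \<Longrightarrow>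
       isCont (\<mu> i) s \<and> \<mu> i s \<in> ball 0 \<delta> \<and> (s \<noteq> s0 \<longrightarrow> \<mu> i s \<noteq> 0)"
    by (auto simp: eventually_nhds_metric dist_commute)
  show ?thesis
    unfolding exponents_through_zero_def
  proof (rule conjI[OF \<open>m \<ge> 1\<close>], rule exI[of _ \<epsilon>], rule conjI[OF \<epsilon>(1)],
      rule exI[of _ \<delta>], rule conjI[OF \<delta>(1)], intro conjI ballI allI impI)
    fix s assume s: "s \<in> ball s0 \<epsilon>"
    show "char_exponents N \<kappa> (fst (c s)) (snd (c s)) \<inter> ball 0 \<delta> = insert 0 ((\<lambda>i. \<mu> i s) ` {..<m})"
      using QR[OF \<epsilon>(2)[OF s] \<delta>(2)] \<epsilon>(3)[OF s] \<delta>(1) by auto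
  next
    fix i assume "i < m"
    then show "continuous_on (ball s0 \<epsilon>) (\<mu> i)"
      using \<epsilon>(3) continuous_at_imp_continuous_on by blast
  qed (use assms \<delta> \<epsilon> in auto)
qed

section \<open>The two roots near a strict minimum\<close>

lemma increasing_right_root:
  fixes G :: "real \<Rightarrow> real"
  assumes "e > 0" "G 0 = 0"
    and cont: "continuous_on {0..<e} G"
    and deriv: "\<And>t. 0 < t \<Longrightarrow> t < e \<Longrightarrow> \<exists>y. (G has_real_derivative y) (at t) \<and> y > 0"
  obtains e0 y where "e0 > 0" and "(y \<longlongrightarrow> 0) (at_right 0)"
    and "\<And>d. 0 < d \<Longrightarrow> d < e0 \<Longrightarrow> 0 < y d \<and> y d < e \<and> (\<forall>t\<in>{0..<e}. G t = d \<longleftrightarrow> t = y d)"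
proof -
  \<comment> \<open>The derivative may vanish at 0, as it does at a fold, so the inverse function
    theorem is replaced by strict monotonicity and the intermediate value theorem.\<close>
  have mono: "G s < G t" if "0 \<le> s" "s < t" "t < e" for s t
    using that deriv cont
    by (intro DERIV_pos_imp_increasing_open[of s t G]) (auto intro: continuous_on_subset)
  \<comment> \<open>The intermediate value theorem needs a compact interval inside
    \<open>{0..<e}\<close>; \<open>{0..e / 2}\<close> is taken, so the attained values reach up to
    \<open>G (e / 2)\<close>.\<close>
  define e0 where "e0 = G (e / 2)"
  have "e0 > 0"
    using mono[of 0 "e / 2"] assms(1,2) by (simp add: e0_def)
  have "\<exists>t. 0 \<le> t \<and> t \<le> e / 2 \<and> G t = d" if "0 < d" "d < e0" for d
    using that assms(1,2) cont
    by (intro IVT') (auto simp: e0_def intro: continuous_on_subset)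
  then obtain y where y: "\<And>d. 0 < d \<Longrightarrow> d < e0 \<Longrightarrow> 0 \<le> y d \<and> y d \<le> e / 2 \<and> G (y d) = d"
    by metis
  have pos: "0 < y d" "y d < e" "G (y d) = d" if "0 < d" "d < e0" for d
    using y[OF that] that assms(1,2) by (auto simp: less_le)
  have ev: "\<forall>\<^sub>F d in at_right 0. d \<in> {0<..<e0}"
    using \<open>e0 > 0\<close> by (intro eventually_at_right_real)
  have "(y \<longlongrightarrow> 0) (at_right 0)"
  proof (rule order_tendstoI)
    fix a :: real assume "a < 0"
    show "\<forall>\<^sub>F d in at_right 0. a < y d"
      using ev by eventually_elim (use pos \<open>a < 0\<close> in force)
  next
    fix a :: real assume "0 < a"
    \<comment> \<open>The cap keeps \<open>b\<close> in the domain of \<open>G\<close>. Once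
      \<open>d < G b\<close>, monotonicity forces \<open>y d < b \<le> a\<close>.\<close>
    define b where "b = min a (e / 2)"
    have b: "0 < b" "b < e" "b \<le> a"
      using \<open>0 < a\<close> assms(1) by (auto simp: b_def)
    then have "0 < G b"
      using mono[of 0 b] assms(2) by simp
    then have "\<forall>\<^sub>F d in at_right 0. d \<in> {0<..<G b}"
      by (intro eventually_at_right_real)
    with ev show "\<forall>\<^sub>F d in at_right 0. y d < a"
    proof eventually_elim
      case (elim d)
      then have "\<not> b \<le> y d"
        using pos[of d] mono[of b "y d"] b by fastforce
      then show ?case
        using b by simp
    qed
  qed
  moreover have "G t = d \<longleftrightarrow> t = y d" if "0 < d" "d < e0" "t \<in> {0..<e}" for t d
    using pos[OF that(1,2)] mono[of t "y d"] mono[of "y d" t] that(3)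
    by (cases t "y d" rule: linorder_cases) auto
  ultimately show thesis
    using that[of e0 y] \<open>e0 > 0\<close> pos by blast
qed

text \<open>Both \<open>H (x0 + t)\<close> and \<open>H (x0 - t)\<close> increase strictly in
  \<open>t \<ge> 0\<close> from the value 0, so each side contributes exactly one root of
  \<open>H x = d\<close> for small positive \<open>d\<close>.\<close>

lemma strict_minimum_two_roots:
  fixes H H' :: "real \<Rightarrow> real"
  assumes "e > 0" "H x0 = 0"
    and deriv: "\<And>x. x \<in> ball x0 e \<Longrightarrow> (H has_real_derivative H' x) (at x)"
    and sign: "\<And>x. x \<in> ball x0 e \<Longrightarrow> x \<noteq> x0 \<Longrightarrow> (x - x0) * H' x > 0"
  obtains e0 x1 x2 where "e0 > 0"
    and "(x1 \<longlongrightarrow> x0) (at_right 0)" "(x2 \<longlongrightarrow> x0) (at_right 0)"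
    and "\<And>d. 0 < d \<Longrightarrow> d < e0 \<Longrightarrow> {x \<in> ball x0 e. H x = d} = {x1 d, x2 d} \<and> x1 d < x0 \<and> x0 < x2 d"
    and "\<And>x. x \<in> ball x0 e \<Longrightarrow> x \<noteq> x0 \<Longrightarrow> H x > 0"
proof -
  have dR: "((\<lambda>t. H (x0 + t)) has_real_derivative H' (x0 + t)) (at t)"
    if "\<bar>t\<bar> < e" for t
    using deriv[of "x0 + t"] that DERIV_shift[of H "H' (x0 + t)" t x0]
    by (simp add: dist_real_def add.commute)
  have dL: "((\<lambda>t. H (x0 - t)) has_real_derivative - H' (x0 - t)) (at t)" if "\<bar>t\<bar> < e" for t
  proof -
    have "(H has_real_derivative H' (x0 - t)) (at (x0 - t))"
      using deriv[of "x0 - t"] that by (simp add: dist_real_def)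
    moreover have "((\<lambda>t. x0 - t) has_real_derivative - 1) (at t)"
      by (auto intro!: derivative_eq_intros)
    ultimately show ?thesis
      using DERIV_chain2[of H "H' (x0 - t)" "\<lambda>t. x0 - t" t "- 1"] by simp
  qed
  have posR: "H' (x0 + t) > 0" if "0 < t" "t < e" for t
    using sign[of "x0 + t"] that by (simp add: dist_real_def zero_less_mult_iff)
  have posL: "- H' (x0 - t) > 0" if "0 < t" "t < e" for t
    using sign[of "x0 - t"] that by (simp add: dist_real_def zero_less_mult_iff mult_less_0_iff)
  have contR: "continuous_on {0..<e} (\<lambda>t. H (x0 + t))"
    by (intro continuous_at_imp_continuous_on ballI DERIV_isCont[OF dR]) auto
  have contL: "continuous_on {0..<e} (\<lambda>t. H (x0 - t))"
    by (intro continuous_at_imp_continuous_on ballI DERIV_isCont[OF dL]) auto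
  obtain eR yR where R: "eR > 0" "(yR \<longlongrightarrow> 0) (at_right 0)"
    "\<And>d. 0 < d \<Longrightarrow> d < eR \<Longrightarrow> 0 < yR d \<and> yR d < e \<and> (\<forall>t\<in>{0..<e}. H (x0 + t) = d \<longleftrightarrow> t = yR d)"
  proof (rule increasing_right_root[of e "\<lambda>t. H (x0 + t)"])
    show "\<exists>y. ((\<lambda>t. H (x0 + t)) has_real_derivative y) (at t) \<and> y > 0" if "0 < t" "t < e" for t
      using dR[of t] posR[of t] that by auto
  qed (use assms contR in auto)
  obtain eL yL where L: "eL > 0" "(yL \<longlongrightarrow> 0) (at_right 0)"
    "\<And>d. 0 < d \<Longrightarrow> d < eL \<Longrightarrow> 0 < yL d \<and> yL d < e \<and> (\<forall>t\<in>{0..<e}. H (x0 - t) = d \<longleftrightarrow> t = yL d)"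
  proof (rule increasing_right_root[of e "\<lambda>t. H (x0 - t)"])
    show "\<exists>y. ((\<lambda>t. H (x0 - t)) has_real_derivative y) (at t) \<and> y > 0" if "0 < t" "t < e" for t
      using dL[of t] posL[of t] that by auto
  qed (use assms contL in auto)
  show thesis
  proof (rule that[of "min eL eR" "\<lambda>d. x0 - yL d" "\<lambda>d. x0 + yR d"])
    show "min eL eR > 0"
      using R L by simp
    show "((\<lambda>d. x0 - yL d) \<longlongrightarrow> x0) (at_right 0)" "((\<lambda>d. x0 + yR d) \<longlongrightarrow> x0) (at_right 0)"
      using tendsto_diff[OF tendsto_const L(2), of x0] tendsto_add[OF tendsto_const R(2), of x0]
      by simp_all
  next
    fix d :: real assume d: "0 < d" "d < min eL eR"
    have r: "0 < yR d" "yR d < e" "\<And>t. t \<in> {0..<e} \<Longrightarrow> H (x0 + t) = d \<longleftrightarrow> t = yR d"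
      and l: "0 < yL d" "yL d < e" "\<And>t. t \<in> {0..<e} \<Longrightarrow> H (x0 - t) = d \<longleftrightarrow> t = yL d"
      using R(3)[of d] L(3)[of d] d by auto
    have "H x = d \<longleftrightarrow> x = x0 - yL d \<or> x = x0 + yR d" if "x \<in> ball x0 e" for x
    proof (cases "x \<ge> x0")
      case True
      then show ?thesis
        using r(3)[of "x - x0"] l(1) that by (auto simp: dist_real_def)
    next
      case False
      then show ?thesis
        using l(3)[of "x0 - x"] r(1) that by (auto simp: dist_real_def)
    qed
    moreover have "x0 - yL d \<in> ball x0 e" "x0 + yR d \<in> ball x0 e"
      using l(1,2) r(1,2) by (auto simp: dist_real_def)
    ultimately show "{x \<in> ball x0 e. H x = d} = {x0 - yL d, x0 + yR d} \<and>
        x0 - yL d < x0 \<and> x0 < x0 + yR d"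
      using l(1) r(1) by auto
  next
    fix x assume x: "x \<in> ball x0 e" "x \<noteq> x0"
    show "H x > 0"
    proof (cases "x > x0")
      case True
      then have "H (x0 + 0) < H (x0 + (x - x0))"
        using x posR dR continuous_on_subset[OF contR, of "{0..x - x0}"]
        by (intro DERIV_pos_imp_increasing_open[where f = "\<lambda>t. H (x0 + t)"])
          (force simp: dist_real_def)+
      then show ?thesis
        using assms(2) by simp
    next
      case False
      then have "H (x0 - 0) < H (x0 - (x0 - x))"
        using x posL dL continuous_on_subset[OF contL, of "{0..x0 - x}"]
        by (intro DERIV_pos_imp_increasing_open[where f = "\<lambda>t. H (x0 - t)"])
          (force simp: dist_real_def)+
      then show ?thesis
        using assms(2) by simp
    qed
  qed
qed

subsection \<open>The rescaled characteristic equation\<close>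

definition scaled_char :: "complex \<Rightarrow> complex \<Rightarrow> complex \<Rightarrow> bool" where
  "scaled_char z k u \<longleftrightarrow> u + k - k * exp (- u) * z = 0"

definition ring_root :: "nat \<Rightarrow> nat \<Rightarrow> complex" where
  "ring_root N n = exp (2 * of_real pi * \<i> * of_nat n / of_nat N)"

lemma cmod_ring_root: "cmod (ring_root N n) = 1"
  by (simp add: ring_root_def)

lemma ring_root_neq_1: "n \<in> {1..<N} \<Longrightarrow> ring_root N n \<noteq> 1"
  using complex_root_unity_eq_1[of N n] by (auto simp: ring_root_def dest: dvd_imp_le)

text \<open>The equation is multiplied by \<tau>. The index 0 is split off because its root of unity
  is 1, which always admits the trivial solution and hence needs a separate analysis.\<close>

lemma char_exponents_iff_scaled:
  fixes \<kappa> \<tau> \<Omega> :: real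
  assumes "\<tau> \<noteq> 0" "N > 0"
  defines "k \<equiv> of_real (gain \<kappa> \<tau> \<Omega> * \<tau>)"
  shows "\<mu> \<in> char_exponents N \<kappa> \<tau> \<Omega> \<longleftrightarrow>
    scaled_char 1 k (\<mu> * of_real \<tau>) \<or> (\<exists>n\<in>{1..<N}. scaled_char (ring_root N n) k (\<mu> * of_real \<tau>))"
proof -
  have "scaled_char z k (\<mu> * of_real \<tau>) \<longleftrightarrow>
      (\<mu> + of_real (gain \<kappa> \<tau> \<Omega>) - of_real (gain \<kappa> \<tau> \<Omega>) * exp (- \<mu> * of_real \<tau>) * z) * of_real \<tau> = 0"
    for z
    by (simp add: scaled_char_def k_def algebra_simps)
  then have "\<mu> \<in> char_exponents N \<kappa> \<tau> \<Omega> \<longleftrightarrow> (\<exists>n\<in>{..<N}. scaled_char (ring_root N n) k (\<mu> * of_real \<tau>))"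
    using assms(1) by (auto simp: char_exponents_def ring_root_def)
  also have "{..<N} = insert 0 {1..<N}"
    using assms(2) by auto
  finally show ?thesis
    by (simp add: ring_root_def)
qed

text \<open>Where \<open>exp (- u) * z\<close> differs from 1 the equation is equivalent to
  \<open>f u = k\<close>. Since \<open>z \<noteq> 1\<close>, this region contains a neighbourhood of
  0, and \<psi> is the local inverse of \<open>f\<close> there.\<close>

lemma scaled_char_neq_1:
  assumes "z \<noteq> 1"
  obtains \<psi> where "\<psi> 0 = 0" and "(\<psi> has_field_derivative z - 1) (at 0)"
    and "\<forall>\<^sub>F k in nhds 0. isCont \<psi> k"
    and "\<forall>\<^sub>F p in nhds (0, 0). scaled_char z (fst p) (snd p) \<longleftrightarrow> snd p = \<psi> (fst p)"
proof -
  define f where "f u = u / (exp (- u) * z - 1)" for u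
  define f' where "f' u = (exp (- u) * z - 1 + u * exp (- u) * z) / (exp (- u) * z - 1)\<^sup>2" for u
  define U where "U = {u. exp (- u) * z - 1 \<noteq> 0}"
  have "open U"
    unfolding U_def by (intro open_Collect_neq continuous_intros)
  moreover have "0 \<in> U"
    using assms by (simp add: U_def)
  ultimately have U: "open U" "0 \<in> U" .
  have derf: "(f has_field_derivative f' u) (at u)" if "u \<in> U" for u
    using that unfolding f_def f'_def U_def
    by (auto intro!: derivative_eq_intros simp: power2_eq_square algebra_simps)
  have contf': "continuous_on U f'"
    unfolding f'_def by (intro continuous_intros) (simp add: U_def)
  have f'0: "f' 0 = inverse (z - 1)"
    using assms by (simp add: f'_def power2_eq_square inverse_eq_divide)
  have f0: "f 0 = 0"
    by (simp add: f_def)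
  have nz: "f' 0 \<noteq> 0"
    using assms f'0 by simp
  obtain \<psi> where \<psi>': "\<psi> (f 0) = 0"
    "\<forall>\<^sub>F p in nhds (f 0, 0). f (snd p) = fst p \<longleftrightarrow> snd p = \<psi> (fst p)"
    "\<forall>\<^sub>F k in nhds (f 0). f (\<psi> k) = k"
    "\<forall>\<^sub>F k in nhds (f 0). (\<psi> has_field_derivative inverse (f' (\<psi> k))) (at k)"
    by (rule DERIV_local_inverse[OF U ballI[OF derf] contf' nz])
  note \<psi> = \<psi>'[unfolded f0]
  show thesis
  proof
    have "\<forall>\<^sub>F p in nhds (0 :: complex, 0). snd p \<in> U"
      using eventually_nhds_in_open[OF open_vimage_snd[OF U(1)], of "(0, 0)"] U(2) by simp
    with \<psi>(2) show "\<forall>\<^sub>F p in nhds (0, 0). scaled_char z (fst p) (snd p) \<longleftrightarrow> snd p = \<psi> (fst p)"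
    proof eventually_elim
      case (elim p)
      then have "scaled_char z (fst p) (snd p) \<longleftrightarrow> f (snd p) = fst p"
        by (auto simp: scaled_char_def f_def U_def field_simps)
      with elim show ?case
        by simp
    qed
    show "(\<psi> has_field_derivative z - 1) (at 0)"
      using eventually_nhds_x_imp_x[OF \<psi>(4)] \<psi>(1) f'0 by simp
    show "\<forall>\<^sub>F k in nhds 0. isCont \<psi> k"
      using \<psi>(4) by eventually_elim (rule DERIV_isCont)
  qed (fact \<psi>(1))
qed

section \<open>The equation for the root of unity 1\<close>

definition expm1_quot :: "complex \<Rightarrow> complex" where
  "expm1_quot u = (if u = 0 then - 1 else (exp (- u) - 1) / u)"

lemma mult_expm1_quot: "u * expm1_quot u = exp (- u) - 1"
  by (simp add: expm1_quot_def)

text \<open>The value - 1 at 0 is the derivative of \<open>exp (- u) - 1\<close> there, so the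
  function is a difference quotient with its removable singularity filled in.\<close>

lemma holomorphic_expm1_quot: "expm1_quot holomorphic_on UNIV"
proof -
  have "((\<lambda>u. exp (- u) - 1) has_field_derivative - 1) (at (0::complex))"
    by (auto intro!: derivative_eq_intros)
  then have "deriv (\<lambda>u. exp (- u) - 1) (0::complex) = - 1"
    by (rule DERIV_imp_deriv)
  moreover have "(\<lambda>u. exp (- u) - 1 :: complex) holomorphic_on UNIV"
    by (intro holomorphic_intros)
  then have "(\<lambda>z. if z = 0 then deriv (\<lambda>u. exp (- u) - 1) 0
      else (exp (- z) - 1 - (exp (- 0) - 1)) / (z - 0)) holomorphic_on (UNIV :: complex set)"
    by (rule pole_lemma_open) simp
  ultimately show ?thesis
    by (simp add: expm1_quot_def[abs_def] cong: if_cong)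
qed

lemma DERIV_expm1_quot: "(expm1_quot has_field_derivative deriv expm1_quot u) (at u)"
  using holomorphic_expm1_quot by (intro holomorphic_derivI) auto

lemma isCont_expm1_quot: "isCont expm1_quot u"
  using DERIV_expm1_quot by (rule DERIV_isCont)

lemma deriv_expm1_quot_0: "deriv expm1_quot 0 = 1 / 2"
proof -
  \<comment> \<open>differentiate \<open>u q(u) = e\<^sup>-\<^sup>u - 1\<close> twice at \<open>0\<close>\<close>
  have h': "deriv expm1_quot holomorphic_on UNIV"
    using holomorphic_expm1_quot by (intro holomorphic_deriv) auto
  have d': "(deriv expm1_quot has_field_derivative deriv (deriv expm1_quot) u) (at u)" for u
    using h' by (intro holomorphic_derivI) auto
  have e: "expm1_quot u + u * deriv expm1_quot u = - exp (- u)" for u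
  proof (rule DERIV_unique)
    show "((\<lambda>u. u * expm1_quot u) has_field_derivative expm1_quot u + u * deriv expm1_quot u) (at u)"
      by (auto intro!: derivative_eq_intros DERIV_expm1_quot)
    show "((\<lambda>u. u * expm1_quot u) has_field_derivative - exp (- u)) (at u)"
      unfolding mult_expm1_quot by (auto intro!: derivative_eq_intros)
  qed
  have "2 * deriv expm1_quot 0 = 1"
  proof (rule DERIV_unique)
    show "((\<lambda>u. expm1_quot u + u * deriv expm1_quot u) has_field_derivative 2 * deriv expm1_quot 0) (at 0)"
      by (auto intro!: derivative_eq_intros DERIV_expm1_quot d')
    show "((\<lambda>u. expm1_quot u + u * deriv expm1_quot u) has_field_derivative 1) (at 0)"
      unfolding e by (auto intro!: derivative_eq_intros)
  qed
  then show ?thesis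
    by (simp add: field_simps)
qed

text \<open>Dividing out the trivial root \<open>u = 0\<close> leaves the reciprocal of the function to be inverted.\<close>

lemma scaled_char_1_iff: "scaled_char 1 k u \<longleftrightarrow> u = 0 \<or> k * expm1_quot u = 1"
proof -
  have "u + k - k * exp (- u) = u * (1 - k * expm1_quot u)"
    using mult_expm1_quot[of u] by algebra
  then show ?thesis
    by (auto simp: scaled_char_def)
qed

text \<open>A nontrivial solution needs \<open>k * expm1_quot u = 1\<close>, but this product is
  continuous and vanishes at the origin.\<close>

lemma scaled_char_1_near_0:
  "\<forall>\<^sub>F p in nhds (0, 0). scaled_char 1 (fst p) (snd p) \<longleftrightarrow> snd p = 0"
proof -
  have "isCont (\<lambda>p. fst p * expm1_quot (snd p)) (0, 0)"
    by (intro continuous_intros isCont_o2[OF _ isCont_expm1_quot])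
  then have "\<forall>\<^sub>F p in nhds (0, 0). fst p * expm1_quot (snd p) \<in> - {1}"
    by (rule isCont_eventually) (rule eventually_nhds_in_open, auto)
  then show ?thesis
    by eventually_elim (auto simp: scaled_char_1_iff)
qed

text \<open>Nontrivial solutions satisfy \<open>k = inverse (expm1_quot u)\<close>. As
  \<open>expm1_quot\<close> has value - 1 and derivative 1/2 at 0, this reciprocal has slope - 1/2
  and its local inverse \<psi> has slope - 2. The branch \<psi> meets the trivial one at
  \<open>k = - 1\<close>.\<close>

lemma scaled_char_1_near_minus_1:
  obtains \<psi> where "\<psi> (- 1) = 0" and "(\<psi> has_field_derivative - 2) (at (- 1))"
    and "\<forall>\<^sub>F k in nhds (- 1). isCont \<psi> k"
    and "\<forall>\<^sub>F p in nhds (- 1, 0). scaled_char 1 (fst p) (snd p) \<longleftrightarrow> snd p = 0 \<or> snd p = \<psi> (fst p)"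
proof -
  define U where "U = {u. expm1_quot u \<noteq> 0}"
  define f' where "f' u = - deriv expm1_quot u / (expm1_quot u)\<^sup>2" for u
  have cont: "continuous_on A expm1_quot" "continuous_on A (deriv expm1_quot)" for A
    using holomorphic_expm1_quot holomorphic_deriv[OF holomorphic_expm1_quot]
    by (auto intro: continuous_on_subset holomorphic_on_imp_continuous_on)
  have U: "open U" "0 \<in> U"
    unfolding U_def by (intro open_Collect_neq cont continuous_on_const) (simp add: expm1_quot_def)
  have derf: "((\<lambda>u. inverse (expm1_quot u)) has_field_derivative f' u) (at u)" if "u \<in> U" for u
    using that unfolding f'_def U_def
    by (auto intro!: derivative_eq_intros DERIV_expm1_quot simp: power2_eq_square field_simps)
  have contf': "continuous_on U f'"
    unfolding f'_def by (intro continuous_intros cont) (simp add: U_def)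
  have f'0: "f' 0 = - (1 / 2)"
    by (simp add: f'_def deriv_expm1_quot_0 expm1_quot_def)
  have f0: "inverse (expm1_quot 0) = - 1"
    by (simp add: expm1_quot_def)
  have nz: "f' 0 \<noteq> 0"
    using f'0 by simp
  obtain \<psi> where \<psi>': "\<psi> (inverse (expm1_quot 0)) = 0"
    "\<forall>\<^sub>F p in nhds (inverse (expm1_quot 0), 0).
       inverse (expm1_quot (snd p)) = fst p \<longleftrightarrow> snd p = \<psi> (fst p)"
    "\<forall>\<^sub>F k in nhds (inverse (expm1_quot 0)). inverse (expm1_quot (\<psi> k)) = k"
    "\<forall>\<^sub>F k in nhds (inverse (expm1_quot 0)). (\<psi> has_field_derivative inverse (f' (\<psi> k))) (at k)"
    by (rule DERIV_local_inverse[OF U ballI[OF derf] contf' nz])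
  note \<psi> = \<psi>'[unfolded f0]
  show thesis
  proof
    have "\<forall>\<^sub>F p in nhds (- 1 :: complex, 0). snd p \<in> U"
      using eventually_nhds_in_open[OF open_vimage_snd[OF U(1)], of "(- 1, 0)"] U(2) by simp
    with \<psi>(2) show "\<forall>\<^sub>F p in nhds (- 1, 0). scaled_char 1 (fst p) (snd p) \<longleftrightarrow>
        snd p = 0 \<or> snd p = \<psi> (fst p)"
    proof eventually_elim
      case (elim p)
      then have "fst p * expm1_quot (snd p) = 1 \<longleftrightarrow> inverse (expm1_quot (snd p)) = fst p"
        by (auto simp: U_def field_simps)
      with elim show ?case
        by (simp add: scaled_char_1_iff)
    qed
    show "(\<psi> has_field_derivative - 2) (at (- 1))"
      using eventually_nhds_x_imp_x[OF \<psi>(4)] \<psi>(1) f'0 by simp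
    show "\<forall>\<^sub>F k in nhds (- 1). isCont \<psi> k"
      using \<psi>(4) by eventually_elim (rule DERIV_isCont)
  qed (fact \<psi>(1))
qed

text \<open>At \<open>k = - 1\<close>, \<open>u = 0\<close> the left side of the equation equals
  \<open>z - 1\<close>, and it stays nonzero nearby by continuity.\<close>

lemma scaled_char_near_minus_1:
  assumes "z \<noteq> 1"
  shows "\<forall>\<^sub>F p in nhds (- 1, 0). \<not> scaled_char z (fst p) (snd p)"
proof -
  have "isCont (\<lambda>p. snd p + fst p - fst p * exp (- snd p) * z) (- 1, 0)"
    by (intro continuous_intros)
  then have "\<forall>\<^sub>F p in nhds (- 1, 0). snd p + fst p - fst p * exp (- snd p) * z \<in> - {0}"
    by (rule isCont_eventually) (rule eventually_nhds_in_open, use assms in auto)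
  then show ?thesis
    by eventually_elim (auto simp: scaled_char_def)
qed

subsection \<open>Exponents through zero\<close>

text \<open>Pullback along the continuous map taking \<open>(s, \<mu>)\<close> to
  \<open>(k s, \<mu> T s)\<close>, which sends \<open>(s0, 0)\<close> to \<open>(k s0, 0)\<close>.
  It transfers the local descriptions of the rescaled roots to exponents along a curve with delay
  \<open>T s\<close>.\<close>

lemma eventually_rescaled:
  fixes k :: "real \<Rightarrow> complex" and T :: "real \<Rightarrow> real"
  assumes "\<forall>\<^sub>F q in nhds (k s0, 0 :: complex). \<Phi> (fst q) (snd q)" and k: "isCont k s0" and T: "isCont T s0"
  shows "\<forall>\<^sub>F p in nhds (s0, 0 :: complex). \<Phi> (k (fst p)) (snd p * of_real (T (fst p)))"
proof -
  have *: "isCont (\<lambda>p. k (fst p)) (s0, 0 :: complex)" "isCont (\<lambda>p. T (fst p)) (s0, 0 :: complex)"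
    using isCont_o2[of "(s0, 0)" fst k] isCont_o2[of "(s0, 0)" fst T] k T
    by (simp_all add: continuous_fst)
  have "isCont (\<lambda>p. (k (fst p), snd p * of_real (T (fst p)))) (s0, 0 :: complex)"
    by (intro continuous_intros *)
  from isCont_eventually[OF this, of "\<lambda>q. \<Phi> (fst q) (snd q)"] show ?thesis
    using assms(1) by simp
qed

text \<open>In the product rule, the term from differentiating \<open>inverse (T s)\<close> carries
  the factor \<open>\<psi> (of_real (k s0)) = 0\<close>, which leaves only the chain rule
  term.\<close>

lemma has_vector_derivative_rescaled:
  fixes \<psi> :: "complex \<Rightarrow> complex" and k T :: "real \<Rightarrow> real"
  assumes "(\<psi> has_field_derivative w) (at (of_real (k s0)))" and zero: "\<psi> (of_real (k s0)) = 0"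
    and "(k has_real_derivative k') (at s0)" and "(T has_real_derivative T') (at s0)" "T s0 \<noteq> 0"
  shows "((\<lambda>s. inverse (T s) *\<^sub>R \<psi> (of_real (k s))) has_vector_derivative
    (k' / T s0) *\<^sub>R w) (at s0)"
proof -
  have "((\<lambda>s. complex_of_real (k s)) has_vector_derivative of_real k') (at s0)"
    using assms(3) by (intro has_vector_derivative_of_real)
      (simp add: has_real_derivative_iff_has_vector_derivative)
  then have \<psi>: "((\<lambda>s. \<psi> (of_real (k s))) has_vector_derivative of_real k' * w) (at s0)"
    using field_vector_diff_chain_at[where f = "\<lambda>s. complex_of_real (k s)" and g = \<psi>] assms(1)
    by (simp add: o_def)
  have "((\<lambda>s. inverse (T s)) has_field_derivative - (inverse (T s0) * T' * inverse (T s0))) (at s0)"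
    using assms(4,5) by (rule DERIV_inverse')
  from has_vector_derivative_scaleR[OF this \<psi>] show ?thesis
    by (simp add: zero scaleR_conv_of_real field_simps)
qed

lemma has_real_derivative_Re:
  assumes "(f has_vector_derivative v) (at x)"
  shows "((\<lambda>t. Re (f t)) has_real_derivative Re v) (at x)"
  using bounded_linear.has_vector_derivative[OF bounded_linear_Re assms]
  by (simp add: has_real_derivative_iff_has_vector_derivative)

lemma eventually_Re_sign:
  assumes "(f has_vector_derivative v) (at x0)" "f x0 = 0" "Re v \<noteq> 0"
  shows "\<forall>\<^sub>F x in at x0. Re v * (x - x0) * Re (f x) > 0"
  using DERIV_eventually_sign[OF has_real_derivative_Re[OF assms(1)]] assms(2,3) by simp

lemma exponents_through_zero_mem:
  assumes "exponents_through_zero N \<kappa> c s0 m \<mu>" "i < m"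
  shows "\<forall>\<^sub>F s in nhds s0. \<mu> i s \<in> char_exponents N \<kappa> (fst (c s)) (snd (c s))"
proof -
  obtain \<epsilon> \<delta> where "\<epsilon> > 0" and *: "\<And>s. s \<in> ball s0 \<epsilon> \<Longrightarrow>
      char_exponents N \<kappa> (fst (c s)) (snd (c s)) \<inter> ball 0 \<delta> = insert 0 ((\<lambda>i. \<mu> i s) ` {..<m})"
    using assms(1) unfolding exponents_through_zero_def by blast
  have "\<mu> i s \<in> char_exponents N \<kappa> (fst (c s)) (snd (c s))" if "s \<in> ball s0 \<epsilon>" for s
    using *[OF that] assms(2) by blast
  then show ?thesis
    using \<open>\<epsilon> > 0\<close> unfolding eventually_nhds by (intro exI[of _ "ball s0 \<epsilon>"]) auto
qed

lemma Re_less_1_if_norm_1: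
  assumes "cmod z = 1" "z \<noteq> 1"
  shows "Re z < 1"
proof -
  have "Re z \<noteq> 1"
    using assms by (auto simp: complex_eq_iff cmod_def)
  then show ?thesis
    using complex_Re_le_cmod[of z] assms(1) by linarith
qed

text \<open>Each nontrivial root of unity contributes one exponent, with velocity
  \<open>D * (\<zeta> n - 1)\<close>; the root 1 contributes only the trivial exponent. Since
  \<open>Re (\<zeta> n) < 1\<close>, all real parts move against the gain, which is the sign
  statement \<open>Re v * D < 0\<close>.\<close>

lemma exponents_at_zero_gain:
  assumes "N \<ge> 2" "\<tau>0 > 0"
    and cont: "\<forall>\<^sub>F \<tau> in nhds \<tau>0. isCont g \<tau>"
    and zero: "gain \<kappa> \<tau>0 (g \<tau>0) = 0"
    and deriv: "((\<lambda>\<tau>. gain \<kappa> \<tau> (g \<tau>)) has_real_derivative D) (at \<tau>0)" and "D \<noteq> 0"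
  obtains \<mu> where "exponents_through_zero N \<kappa> (\<lambda>\<tau>. (\<tau>, g \<tau>)) \<tau>0 (N - 1) \<mu>"
    and "\<And>i. i < N - 1 \<Longrightarrow> \<exists>v. (\<mu> i has_vector_derivative v) (at \<tau>0) \<and> Re v * D < 0"
proof -
  define \<zeta> where "\<zeta> = ring_root N"
  have \<zeta>1: "\<zeta> n \<noteq> 1" if "n \<in> {1..<N}" for n
    unfolding \<zeta>_def using that by (rule ring_root_neq_1)
  have norm: "cmod (\<zeta> n) = 1" for n
    by (simp add: \<zeta>_def cmod_ring_root)
  have "\<forall>n\<in>{1..<N}. \<exists>\<psi>. \<psi> 0 = 0 \<and> (\<psi> has_field_derivative \<zeta> n - 1) (at 0) \<and>
      (\<forall>\<^sub>F k in nhds 0. isCont \<psi> k) \<and>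
      (\<forall>\<^sub>F p in nhds (0, 0). scaled_char (\<zeta> n) (fst p) (snd p) \<longleftrightarrow> snd p = \<psi> (fst p))"
  proof
    fix n assume "n \<in> {1..<N}"
    show "\<exists>\<psi>. \<psi> 0 = 0 \<and> (\<psi> has_field_derivative \<zeta> n - 1) (at 0) \<and>
      (\<forall>\<^sub>F k in nhds 0. isCont \<psi> k) \<and>
      (\<forall>\<^sub>F p in nhds (0, 0). scaled_char (\<zeta> n) (fst p) (snd p) \<longleftrightarrow> snd p = \<psi> (fst p))"
      by (rule scaled_char_neq_1[OF \<zeta>1[OF \<open>n \<in> {1..<N}\<close>]]) (intro exI conjI)
  qed
  from bchoice[OF this] obtain \<psi> where \<psi>: "\<And>n. n \<in> {1..<N} \<Longrightarrow> \<psi> n 0 = 0"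
    "\<And>n. n \<in> {1..<N} \<Longrightarrow> (\<psi> n has_field_derivative \<zeta> n - 1) (at 0)"
    "\<And>n. n \<in> {1..<N} \<Longrightarrow> \<forall>\<^sub>F k in nhds 0. isCont (\<psi> n) k"
    "\<And>n. n \<in> {1..<N} \<Longrightarrow> \<forall>\<^sub>F p in nhds (0, 0).
       scaled_char (\<zeta> n) (fst p) (snd p) \<longleftrightarrow> snd p = \<psi> n (fst p)"
    by blast
  define k where "k = (\<lambda>\<tau>. gain \<kappa> \<tau> (g \<tau>) * \<tau>)"
  have k0: "k \<tau>0 = 0"
    by (simp add: k_def zero)
  \<comment> \<open>The other term of the product rule is the gain at \<open>\<tau>0\<close>, which
    is 0.\<close>
  have dk: "(k has_real_derivative D * \<tau>0) (at \<tau>0)"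
    unfolding k_def using zero by (auto intro!: derivative_eq_intros deriv)
  have contk: "\<forall>\<^sub>F \<tau> in nhds \<tau>0. isCont k \<tau>"
    using cont by (auto elim!: eventually_mono simp: k_def gain_def intro!: continuous_intros)
  have contk0: "isCont (\<lambda>\<tau>. complex_of_real (k \<tau>)) \<tau>0"
    using dk by (intro continuous_intros DERIV_isCont)
  \<comment> \<open>The shift by \<open>Suc\<close> skips the index 0 of the trivial exponent, so
    \<open>i < N - 1\<close> runs through the nontrivial roots of unity.\<close>
  define \<mu> where "\<mu> i = (\<lambda>\<tau>. inverse \<tau> *\<^sub>R \<psi> (Suc i) (of_real (k \<tau>)))" for i
  have d\<mu>: "(\<mu> i has_vector_derivative D *\<^sub>R (\<zeta> (Suc i) - 1)) (at \<tau>0)" if "i < N - 1" for i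
    using has_vector_derivative_rescaled[of "\<psi> (Suc i)" "\<zeta> (Suc i) - 1" k \<tau>0 "D * \<tau>0" "\<lambda>\<tau>. \<tau>" 1]
      \<psi>(1,2)[of "Suc i"] that dk k0 assms(2) unfolding \<mu>_def by simp
  have "Re (\<zeta> (Suc i) - 1) < 0" if "i < N - 1" for i
    using Re_less_1_if_norm_1[OF norm \<zeta>1, of "Suc i"] that by simp
  moreover have "D * D > 0"
    using \<open>D \<noteq> 0\<close> by (auto simp: zero_less_mult_iff)
  ultimately have Re: "Re (D *\<^sub>R (\<zeta> (Suc i) - 1)) * D < 0" if "i < N - 1" for i
    using that mult_pos_neg[of "D * D" "Re (\<zeta> (Suc i) - 1)"] by (simp add: mult_ac)
  have \<mu>0: "\<mu> i \<tau>0 = 0" if "i < N - 1" for i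
    using that by (simp add: \<mu>_def k0 \<psi>(1))
  have "exponents_through_zero N \<kappa> (\<lambda>\<tau>. (\<tau>, g \<tau>)) \<tau>0 (N - 1) \<mu>"
  proof (rule exponents_through_zeroI)
    show "N - 1 \<ge> 1"
      using assms(1) by simp
  next
    fix i assume i: "i < N - 1"
    then show "\<mu> i \<tau>0 = 0"
      by (rule \<mu>0)
    have "\<forall>\<^sub>F \<tau> in nhds \<tau>0. isCont (\<psi> (Suc i)) (complex_of_real (k \<tau>))"
      using isCont_eventually[OF contk0, of "isCont (\<psi> (Suc i))"] \<psi>(3)[of "Suc i"] i k0 by simp
    moreover have "\<forall>\<^sub>F \<tau> in nhds \<tau>0. \<tau> \<in> {0<..}"
      using assms(2) by (intro eventually_nhds_in_open) auto
    ultimately show "\<forall>\<^sub>F \<tau> in nhds \<tau>0. isCont (\<mu> i) \<tau>"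
      using contk
    proof eventually_elim
      case (elim \<tau>)
      have "isCont (\<lambda>\<tau>. complex_of_real (k \<tau>)) \<tau>"
        using elim by (intro continuous_intros)
      from isCont_o2[OF this elim(1)] elim show ?case
        unfolding \<mu>_def by (intro continuous_intros) auto
    qed
    \<comment> \<open>The exponent is nonzero off \<open>\<tau>0\<close> because already its real
      part has a strict sign there.\<close>
    have "\<forall>\<^sub>F \<tau> in at \<tau>0. Re (D *\<^sub>R (\<zeta> (Suc i) - 1)) * (\<tau> - \<tau>0) * Re (\<mu> i \<tau>) > 0"
      using Re[OF i] by (intro eventually_Re_sign d\<mu> \<mu>0 i) auto
    then show "\<forall>\<^sub>F \<tau> in at \<tau>0. \<mu> i \<tau> \<noteq> 0"
      by eventually_elim auto
  next
    have "\<forall>\<^sub>F p in nhds (\<tau>0, 0). \<forall>n\<in>{1..<N}.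
        scaled_char (\<zeta> n) (of_real (k (fst p))) (snd p * of_real (fst p)) \<longleftrightarrow>
        snd p * of_real (fst p) = \<psi> n (of_real (k (fst p)))"
    proof (intro eventually_ball_finite ballI finite_atLeastLessThan)
      fix n assume "n \<in> {1..<N}"
      then show "\<forall>\<^sub>F p in nhds (\<tau>0, 0).
          scaled_char (\<zeta> n) (of_real (k (fst p))) (snd p * of_real (fst p)) \<longleftrightarrow>
          snd p * of_real (fst p) = \<psi> n (of_real (k (fst p)))"
        using \<psi>(4) contk0 k0
          eventually_rescaled[of "\<lambda>k u. scaled_char (\<zeta> n) k u \<longleftrightarrow> u = \<psi> n k" "\<lambda>\<tau>. of_real (k \<tau>)" \<tau>0 "\<lambda>\<tau>. \<tau>"]
        by simp
    qed
    moreover have "\<forall>\<^sub>F p in nhds (\<tau>0, 0).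
        scaled_char 1 (of_real (k (fst p))) (snd p * of_real (fst p)) \<longleftrightarrow> snd p * of_real (fst p) = 0"
      using scaled_char_1_near_0 contk0 k0
        eventually_rescaled[of "\<lambda>k u. scaled_char 1 k u \<longleftrightarrow> u = 0" "\<lambda>\<tau>. of_real (k \<tau>)" \<tau>0 "\<lambda>\<tau>. \<tau>"]
      by simp
    moreover have "\<forall>\<^sub>F p in nhds (\<tau>0, 0 :: complex). fst p \<in> {0<..}"
      using eventually_nhds_in_open[OF open_vimage_fst[OF open_greaterThan[of 0]], of "(\<tau>0, 0)"]
        assms(2) by simp
    ultimately show "\<forall>\<^sub>F p in nhds (\<tau>0, 0).
        snd p \<in> char_exponents N \<kappa> (fst (fst p, g (fst p))) (snd (fst p, g (fst p))) \<longleftrightarrow>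
        snd p \<in> insert 0 ((\<lambda>i. \<mu> i (fst p)) ` {..<N - 1})"
    proof eventually_elim
      case (elim p)
      then have pos: "fst p \<noteq> 0"
        by simp
      have "snd p * of_real (fst p) = \<psi> n (of_real (k (fst p))) \<longleftrightarrow> snd p = \<mu> (n - 1) (fst p)"
        if "n \<in> {1..<N}" for n
        using pos that by (auto simp: \<mu>_def scaleR_conv_of_real field_simps)
      moreover have "snd p \<in> char_exponents N \<kappa> (fst p) (g (fst p)) \<longleftrightarrow>
          scaled_char 1 (of_real (k (fst p))) (snd p * of_real (fst p)) \<or>
          (\<exists>n\<in>{1..<N}. scaled_char (\<zeta> n) (of_real (k (fst p))) (snd p * of_real (fst p)))"
        using char_exponents_iff_scaled[OF pos, of N] assms(1) unfolding \<zeta>_def k_def by simp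
      moreover have "{..<N - 1} = (\<lambda>n. n - 1) ` {1..<N}"
        by (force simp: image_iff intro!: bexI[of _ "Suc _"])
      ultimately show ?case
        using elim(1,2) pos by (auto)
    qed
  qed
  with d\<mu> Re show thesis
    using that by blast
qed

text \<open>Near \<open>K\<tau> = - 1\<close> the roots of unity other than 1 give no exponent near
  0, and the root 1 gives exactly one besides the trivial one. Its velocity is
  \<open>- 2 * D / h \<Omega>0\<close>, where \<open>D\<close> is the derivative of
  \<open>K\<tau>\<close> along the curve.\<close>

lemma exponents_at_fold:
  assumes "N \<ge> 2" "h \<Omega>0 > 0"
    and cont: "\<forall>\<^sub>F \<Omega> in nhds \<Omega>0. isCont h \<Omega>"
    and dh: "(h has_real_derivative h') (at \<Omega>0)"
    and val: "gain \<kappa> (h \<Omega>0) \<Omega>0 * h \<Omega>0 = - 1"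
    and deriv: "((\<lambda>\<Omega>. gain \<kappa> (h \<Omega>) \<Omega> * h \<Omega>) has_real_derivative D) (at \<Omega>0)" and "D \<noteq> 0"
  obtains \<mu> where "exponents_through_zero N \<kappa> (\<lambda>\<Omega>. (h \<Omega>, \<Omega>)) \<Omega>0 1 \<mu>"
    and "\<exists>v. (\<mu> 0 has_vector_derivative v) (at \<Omega>0) \<and> Re v \<noteq> 0"
proof -
  define \<zeta> where "\<zeta> = ring_root N"
  have \<zeta>1: "\<zeta> n \<noteq> 1" if "n \<in> {1..<N}" for n
    unfolding \<zeta>_def using that by (rule ring_root_neq_1)
  obtain \<psi> where \<psi>: "\<psi> (- 1) = 0" "(\<psi> has_field_derivative - 2) (at (- 1))"
    "\<forall>\<^sub>F k in nhds (- 1). isCont \<psi> k"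
    "\<forall>\<^sub>F p in nhds (- 1, 0). scaled_char 1 (fst p) (snd p) \<longleftrightarrow> snd p = 0 \<or> snd p = \<psi> (fst p)"
    by (rule scaled_char_1_near_minus_1)
  define k where "k = (\<lambda>\<Omega>. gain \<kappa> (h \<Omega>) \<Omega> * h \<Omega>)"
  have k0: "k \<Omega>0 = - 1"
    by (simp add: k_def val)
  have dk: "(k has_real_derivative D) (at \<Omega>0)"
    unfolding k_def by (rule deriv)
  have contk: "\<forall>\<^sub>F \<Omega> in nhds \<Omega>0. isCont k \<Omega>"
    using cont by (auto elim!: eventually_mono simp: k_def gain_def intro!: continuous_intros)
  have contk0: "isCont (\<lambda>\<Omega>. complex_of_real (k \<Omega>)) \<Omega>0"
    using dk by (intro continuous_intros DERIV_isCont)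
  have conth0: "isCont h \<Omega>0"
    using dh by (rule DERIV_isCont)
  have hpos: "\<forall>\<^sub>F \<Omega> in nhds \<Omega>0. h \<Omega> \<in> {0<..}"
    using assms(2) by (intro isCont_eventually[OF conth0] eventually_nhds_in_open) auto
  \<comment> \<open>Constant in \<open>i\<close>: with \<open>m = 1\<close> the family consists of
    \<open>\<mu> 0\<close> alone.\<close>
  define \<mu> where "\<mu> i = (\<lambda>\<Omega>. inverse (h \<Omega>) *\<^sub>R \<psi> (of_real (k \<Omega>)))" for i :: nat
  define v where "v = (D / h \<Omega>0) *\<^sub>R (- 2 :: complex)"
  have d\<mu>: "(\<mu> i has_vector_derivative v) (at \<Omega>0)" for i
    using has_vector_derivative_rescaled[of \<psi> "- 2" k \<Omega>0 D h h'] \<psi>(1,2) dk k0 dh assms(2)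
    unfolding \<mu>_def v_def by simp
  have Re: "Re v \<noteq> 0"
    using \<open>D \<noteq> 0\<close> assms(2) by (simp add: v_def)
  have \<mu>0: "\<mu> i \<Omega>0 = 0" for i
    by (simp add: \<mu>_def k0 \<psi>(1))
  have "exponents_through_zero N \<kappa> (\<lambda>\<Omega>. (h \<Omega>, \<Omega>)) \<Omega>0 1 \<mu>"
  proof (rule exponents_through_zeroI)
    fix i :: nat
    show "\<mu> i \<Omega>0 = 0"
      by (rule \<mu>0)
    have "\<forall>\<^sub>F \<Omega> in nhds \<Omega>0. isCont \<psi> (complex_of_real (k \<Omega>))"
      using isCont_eventually[OF contk0, of "isCont \<psi>"] \<psi>(3) k0 by simp
    then show "\<forall>\<^sub>F \<Omega> in nhds \<Omega>0. isCont (\<mu> i) \<Omega>"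
      using hpos contk cont
    proof eventually_elim
      case (elim \<Omega>)
      have "isCont (\<lambda>\<Omega>. complex_of_real (k \<Omega>)) \<Omega>"
        using elim by (intro continuous_intros)
      from isCont_o2[OF this elim(1)] elim show ?case
        unfolding \<mu>_def by (intro continuous_intros) auto
    qed
    have "\<forall>\<^sub>F \<Omega> in at \<Omega>0. Re v * (\<Omega> - \<Omega>0) * Re (\<mu> i \<Omega>) > 0"
      by (intro eventually_Re_sign d\<mu> \<mu>0 Re)
    then show "\<forall>\<^sub>F \<Omega> in at \<Omega>0. \<mu> i \<Omega> \<noteq> 0"
      by eventually_elim auto
  next
    have "\<forall>\<^sub>F p in nhds (\<Omega>0, 0). \<forall>n\<in>{1..<N}.
        \<not> scaled_char (\<zeta> n) (of_real (k (fst p))) (snd p * of_real (h (fst p)))"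
    proof (intro eventually_ball_finite ballI finite_atLeastLessThan)
      fix n assume "n \<in> {1..<N}"
      then show "\<forall>\<^sub>F p in nhds (\<Omega>0, 0).
          \<not> scaled_char (\<zeta> n) (of_real (k (fst p))) (snd p * of_real (h (fst p)))"
        using scaled_char_near_minus_1[OF \<zeta>1] contk0 conth0 k0
          eventually_rescaled[of "\<lambda>k u. \<not> scaled_char (\<zeta> n) k u" "\<lambda>\<Omega>. of_real (k \<Omega>)" \<Omega>0 h]
        by simp
    qed
    moreover have "\<forall>\<^sub>F p in nhds (\<Omega>0, 0).
        scaled_char 1 (of_real (k (fst p))) (snd p * of_real (h (fst p))) \<longleftrightarrow>
        snd p * of_real (h (fst p)) = 0 \<or> snd p * of_real (h (fst p)) = \<psi> (of_real (k (fst p)))"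
      using \<psi>(4) contk0 conth0 k0
        eventually_rescaled[of "\<lambda>k u. scaled_char 1 k u \<longleftrightarrow> u = 0 \<or> u = \<psi> k" "\<lambda>\<Omega>. of_real (k \<Omega>)" \<Omega>0 h]
      by simp
    moreover have "\<forall>\<^sub>F p in nhds (\<Omega>0, 0 :: complex). h (fst p) \<in> {0<..}"
      using hpos unfolding nhds_prod eventually_prod_filter
      by (intro exI[of _ "\<lambda>\<Omega>. h \<Omega> \<in> {0<..}"] exI[of _ "\<lambda>_. True"]) auto
    ultimately show "\<forall>\<^sub>F p in nhds (\<Omega>0, 0).
        snd p \<in> char_exponents N \<kappa> (fst (h (fst p), fst p)) (snd (h (fst p), fst p)) \<longleftrightarrow>
        snd p \<in> insert 0 ((\<lambda>i. \<mu> i (fst p)) ` {..<1})"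
    proof eventually_elim
      case (elim p)
      then have pos: "h (fst p) \<noteq> 0"
        by simp
      have "snd p * of_real (h (fst p)) = \<psi> (of_real (k (fst p))) \<longleftrightarrow> snd p = \<mu> 0 (fst p)"
        using pos by (auto simp: \<mu>_def scaleR_conv_of_real field_simps)
      moreover have "snd p \<in> char_exponents N \<kappa> (h (fst p)) (fst p) \<longleftrightarrow>
          scaled_char 1 (of_real (k (fst p))) (snd p * of_real (h (fst p))) \<or>
          (\<exists>n\<in>{1..<N}. scaled_char (\<zeta> n) (of_real (k (fst p))) (snd p * of_real (h (fst p))))"
        using char_exponents_iff_scaled[OF pos, of N] assms(1) unfolding \<zeta>_def k_def by simp
      ultimately show ?case
        using elim(1,2) pos by (auto)
    qed
  qed simp
  with d\<mu> Re show thesis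
    using that by blast
qed

subsection \<open>The curve of synchronous solutions\<close>

text \<open>
  \<open>\<tau> \<Omega>\<close> is an injective coordinate along the branch, so by invariance of domain the branch leaves
  out no point of the curve near \<open>(\<tau>0, \<Omega>0)\<close>.
\<close>

lemma sync_branch_covers:
  assumes "N > 0" and branch: "sync_branch N \<omega> \<kappa> S c"
    and s0: "s0 \<in> S" "c s0 = (\<tau>0, \<Omega>0)" and "\<Omega>0 \<noteq> 0"
  shows "\<forall>\<^sub>F \<theta> in nhds (\<tau>0 * \<Omega>0).
    (\<theta> / (\<omega> - \<kappa> * sin \<theta>), \<omega> - \<kappa> * sin \<theta>) \<in> c ` S"
proof -
  \<comment> \<open>Only where the frequency is nonzero can the delay be recovered from \<theta> as
    \<theta> / \<Omega>.\<close>
  define S' where "S' = {s \<in> S. snd (c s) \<noteq> 0}"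
  define f where "f s = fst (c s) * snd (c s)" for s
  have cont: "continuous_on S c" and inj: "inj_on c S" and "open S"
    using branch by (auto simp: sync_branch_def)
  have "open (S \<inter> (\<lambda>s. snd (c s)) -` (- {0}))"
    by (intro continuous_open_preimage continuous_intros cont \<open>open S\<close>)
  also have "S \<inter> (\<lambda>s. snd (c s)) -` (- {0}) = S'"
    by (auto simp: S'_def)
  finally have "open S'" .
  have sub: "S' \<subseteq> S"
    by (auto simp: S'_def)
  have on_curve: "c s = (f s / (\<omega> - \<kappa> * sin (f s)), \<omega> - \<kappa> * sin (f s))" if "s \<in> S'" for s
  proof -
    have "(fst (c s), snd (c s)) \<in> sync_set N \<omega> \<kappa>"
      using branch that by (auto simp: sync_branch_def S'_def)
    from iffD1[OF sync_set_iff[OF assms(1)] this] have "snd (c s) = \<omega> - \<kappa> * sin (f s)"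
      by (simp add: f_def mult.commute)
    moreover from this have "fst (c s) = f s / (\<omega> - \<kappa> * sin (f s))"
      using that by (simp add: S'_def f_def)
    ultimately show ?thesis
      by (simp add: prod_eq_iff)
  qed
  have "continuous_on S' f"
    unfolding f_def by (intro continuous_intros continuous_on_subset[OF cont sub])
  \<comment> \<open>By \<open>on_curve\<close>, \<open>f s\<close> determines \<open>c s\<close>,
    and \<open>c\<close> is injective on \<open>S\<close>.\<close>
  moreover have "inj_on f S'"
    using on_curve inj sub by (intro inj_onI) (metis inj_onD subsetD)
  ultimately have "open (f ` S')"
    using \<open>open S'\<close> by (intro invariance_of_domain)
  moreover have "\<tau>0 * \<Omega>0 \<in> f ` S'"
    using s0 assms(5) by (intro image_eqI[of _ _ s0]) (auto simp: f_def S'_def)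
  ultimately have "\<forall>\<^sub>F \<theta> in nhds (\<tau>0 * \<Omega>0). \<theta> \<in> f ` S'"
    by (rule eventually_nhds_in_open)
  then show ?thesis
  proof eventually_elim
    case (elim \<theta>)
    then obtain s where "s \<in> S'" "\<theta> = f s"
      by blast
    then show ?case
      using on_curve[of s] sub by (auto intro: image_eqI[of _ _ s])
  qed
qed

text \<open>At \<open>K = 0\<close> the map \<open>T\<close>, taking \<theta> to the delay, has
  derivative \<open>1 / \<Omega>0\<close>, so \<theta> is locally a function \<Theta> of \<tau>.
  Then \<open>g\<close> is \<open>W\<close> composed with \<Theta>, and \<open>g' = 0\<close>
  because \<open>W' = - K\<close> vanishes at the point.\<close>

lemma sync_curve_over_delay:
  assumes "N > 0" and branch: "sync_branch N \<omega> \<kappa> S c"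
    and s0: "s0 \<in> S" "c s0 = (\<tau>0, \<Omega>0)" and "\<Omega>0 \<noteq> 0" and zero: "gain \<kappa> \<tau>0 \<Omega>0 = 0"
  obtains g where "g \<tau>0 = \<Omega>0"
    and "\<forall>\<^sub>F \<tau> in nhds \<tau>0. isCont g \<tau>"
    and "\<forall>\<^sub>F \<tau> in nhds \<tau>0. (\<tau>, g \<tau>) \<in> c ` S"
    and "\<forall>\<^sub>F p in nhds (\<tau>0, \<Omega>0). (fst p, snd p) \<in> sync_set N \<omega> \<kappa> \<longrightarrow> snd p = g (fst p)"
    and "(g has_real_derivative 0) (at \<tau>0)"
proof -
  have sync: "(\<tau>0, \<Omega>0) \<in> sync_set N \<omega> \<kappa>"
    using branch s0 by (force simp: sync_branch_def)
  define \<theta>0 where "\<theta>0 = \<tau>0 * \<Omega>0"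
  define W where "W \<theta> = \<omega> - \<kappa> * sin \<theta>" for \<theta>
  define T where "T \<theta> = \<theta> / W \<theta>" for \<theta>
  define T' where "T' \<theta> = (W \<theta> + \<theta> * (\<kappa> * cos \<theta>)) / (W \<theta>)\<^sup>2" for \<theta>
  have W0: "W \<theta>0 = \<Omega>0"
    using sync sync_set_iff[OF assms(1)] by (simp add: W_def \<theta>0_def mult.commute)
  have T0: "T \<theta>0 = \<tau>0"
    using W0 assms(5) by (simp add: T_def \<theta>0_def)
  have cos0: "\<kappa> * cos \<theta>0 = 0"
    using zero by (simp add: gain_def \<theta>0_def mult.commute)
  define U where "U = {\<theta>. W \<theta> \<noteq> 0}"
  have "open U"
    unfolding U_def W_def by (intro open_Collect_neq continuous_intros)
  moreover have "\<theta>0 \<in> U"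
    using assms(5) W0 by (simp add: U_def)
  ultimately have U: "open U" "\<theta>0 \<in> U" .
  have dW: "(W has_real_derivative - (\<kappa> * cos \<theta>)) (at \<theta>)" for \<theta>
    unfolding W_def by (auto intro!: derivative_eq_intros)
  have dT: "\<forall>\<theta>\<in>U. (T has_real_derivative T' \<theta>) (at \<theta>)"
    unfolding T_def T'_def U_def
    by (auto intro!: derivative_eq_intros dW simp: power2_eq_square algebra_simps)
  have contT': "continuous_on U T'"
    unfolding T'_def W_def by (intro continuous_intros) (simp add: U_def W_def)
  have nz: "T' \<theta>0 \<noteq> 0"
    using W0 assms(5) by (simp add: T'_def cos0)
  obtain \<Theta> where \<Theta>': "\<Theta> (T \<theta>0) = \<theta>0"
    "\<forall>\<^sub>F p in nhds (T \<theta>0, \<theta>0). T (snd p) = fst p \<longleftrightarrow> snd p = \<Theta> (fst p)"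
    "\<forall>\<^sub>F \<tau> in nhds (T \<theta>0). T (\<Theta> \<tau>) = \<tau>"
    "\<forall>\<^sub>F \<tau> in nhds (T \<theta>0). (\<Theta> has_field_derivative inverse (T' (\<Theta> \<tau>))) (at \<tau>)"
    by (rule DERIV_local_inverse[OF U dT contT' nz])
  note \<Theta> = \<Theta>'[unfolded T0]
  have d\<Theta>0: "(\<Theta> has_field_derivative inverse (T' \<theta>0)) (at \<tau>0)"
    using eventually_nhds_x_imp_x[OF \<Theta>(4)] \<Theta>(1) by simp
  show thesis
  proof
    show "W (\<Theta> \<tau>0) = \<Omega>0"
      by (simp add: \<Theta>(1) W0)
    show "\<forall>\<^sub>F \<tau> in nhds \<tau>0. isCont (\<lambda>\<tau>. W (\<Theta> \<tau>)) \<tau>"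
      using \<Theta>(4)
      by eventually_elim (use isCont_o2 DERIV_isCont dW in blast)
    show "((\<lambda>\<tau>. W (\<Theta> \<tau>)) has_real_derivative 0) (at \<tau>0)"
      using DERIV_chain2[OF dW d\<Theta>0] \<Theta>(1) cos0 by simp
    have "\<forall>\<^sub>F \<tau> in nhds \<tau>0. (T (\<Theta> \<tau>), W (\<Theta> \<tau>)) \<in> c ` S"
      using isCont_eventually[OF DERIV_isCont[OF d\<Theta>0]]
        sync_branch_covers[OF assms(1-5)] \<Theta>(1)
      by (simp add: \<theta>0_def W_def T_def)
    with \<Theta>(3) show "\<forall>\<^sub>F \<tau> in nhds \<tau>0. (\<tau>, W (\<Theta> \<tau>)) \<in> c ` S"
      by eventually_elim simp
    \<comment> \<open>Uniqueness of \<theta> for given \<tau> is carried over to uniqueness of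
      \<Omega> through \<theta> = \<tau> \<Omega>.\<close>
    have "isCont (\<lambda>p. (fst p, fst p * snd p)) (\<tau>0, \<Omega>0)"
      by (intro continuous_intros)
    from isCont_eventually[OF this, of "\<lambda>p. T (snd p) = fst p \<longleftrightarrow> snd p = \<Theta> (fst p)"]
    have "\<forall>\<^sub>F p in nhds (\<tau>0, \<Omega>0). T (fst p * snd p) = fst p \<longleftrightarrow> fst p * snd p = \<Theta> (fst p)"
      using \<Theta>(2) by (simp add: \<theta>0_def)
    moreover have "\<forall>\<^sub>F p in nhds (\<tau>0, \<Omega>0). snd p \<in> - {0}"
      using eventually_nhds_in_open[OF open_vimage_snd[of "- {0}"], of "(\<tau>0, \<Omega>0)"] assms(5) by auto
    ultimately show "\<forall>\<^sub>F p in nhds (\<tau>0, \<Omega>0).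
        (fst p, snd p) \<in> sync_set N \<omega> \<kappa> \<longrightarrow> snd p = W (\<Theta> (fst p))"
    proof eventually_elim
      case (elim p)
      have "snd p = W (\<Theta> (fst p))" if "(fst p, snd p) \<in> sync_set N \<omega> \<kappa>"
      proof -
        have W: "snd p = W (fst p * snd p)"
          using iffD1[OF sync_set_iff[OF assms(1)] that] by (simp add: W_def mult.commute)
        then have "T (fst p * snd p) = fst p"
          using elim(2) by (simp add: T_def)
        with elim(1) W show ?thesis
          by simp
      qed
      then show ?case ..
    qed
  qed
qed

text \<open>Here \<open>W' = - K\<close> is nonzero, so \<theta> is locally a function \<Theta> of
  \<Omega> with derivative \<open>- 1 / K\<close>, and \<open>h\<close> is \<Theta> / \<Omega>. The
  formula for \<open>h'\<close> is the quotient rule with \<theta> rewritten as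
  \<open>h * \<Omega>\<close>.\<close>

lemma sync_curve_over_frequency:
  assumes "N > 0" and branch: "sync_branch N \<omega> \<kappa> S c"
    and s0: "s0 \<in> S" "c s0 = (\<tau>0, \<Omega>0)" and "\<Omega>0 \<noteq> 0" and nonzero: "gain \<kappa> \<tau>0 \<Omega>0 \<noteq> 0"
  obtains h where "h \<Omega>0 = \<tau>0"
    and "\<forall>\<^sub>F \<Omega> in nhds \<Omega>0. (h \<Omega>, \<Omega>) \<in> c ` S"
    and "\<forall>\<^sub>F p in nhds (\<Omega>0, \<tau>0). (snd p, fst p) \<in> sync_set N \<omega> \<kappa> \<longrightarrow> snd p = h (fst p)"
    and "\<forall>\<^sub>F \<Omega> in nhds \<Omega>0. (h has_real_derivative
      - (1 + gain \<kappa> (h \<Omega>) \<Omega> * h \<Omega>) / (gain \<kappa> (h \<Omega>) \<Omega> * \<Omega>)) (at \<Omega>)"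
proof -
  have sync: "(\<tau>0, \<Omega>0) \<in> sync_set N \<omega> \<kappa>"
    using branch s0 by (force simp: sync_branch_def)
  define \<theta>0 where "\<theta>0 = \<tau>0 * \<Omega>0"
  define W where "W \<theta> = \<omega> - \<kappa> * sin \<theta>" for \<theta>
  have W0: "W \<theta>0 = \<Omega>0"
    using sync sync_set_iff[OF assms(1)] by (simp add: W_def \<theta>0_def mult.commute)
  have dW: "\<forall>\<theta>\<in>UNIV. (W has_real_derivative - (\<kappa> * cos \<theta>)) (at \<theta>)"
    unfolding W_def by (auto intro!: derivative_eq_intros)
  have contW': "continuous_on UNIV (\<lambda>\<theta>. - (\<kappa> * cos \<theta>))"
    by (intro continuous_intros)
  have nz: "- (\<kappa> * cos \<theta>0) \<noteq> 0"
    using nonzero by (simp add: \<theta>0_def gain_def mult.commute)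
  obtain \<Theta> where \<Theta>': "\<Theta> (W \<theta>0) = \<theta>0"
    "\<forall>\<^sub>F p in nhds (W \<theta>0, \<theta>0). W (snd p) = fst p \<longleftrightarrow> snd p = \<Theta> (fst p)"
    "\<forall>\<^sub>F \<Omega> in nhds (W \<theta>0). W (\<Theta> \<Omega>) = \<Omega>"
    "\<forall>\<^sub>F \<Omega> in nhds (W \<theta>0). (\<Theta> has_field_derivative inverse (- (\<kappa> * cos (\<Theta> \<Omega>)))) (at \<Omega>)"
    by (rule DERIV_local_inverse[OF open_UNIV UNIV_I dW contW' nz])
  note \<Theta> = \<Theta>'[unfolded W0]
  have cont\<Theta>: "isCont \<Theta> \<Omega>0"
    using eventually_nhds_x_imp_x[OF \<Theta>(4)] by (rule DERIV_isCont)
  have \<Omega>_nz: "\<forall>\<^sub>F \<Omega> in nhds \<Omega>0. \<Omega> \<in> - {0}"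
    using assms(5) by (intro eventually_nhds_in_open) auto
  show thesis
  proof
    show "\<Theta> \<Omega>0 / \<Omega>0 = \<tau>0"
      using assms(5) by (simp add: \<Theta>(1) \<theta>0_def)
    have "\<forall>\<^sub>F \<Omega> in nhds \<Omega>0. (\<Theta> \<Omega> / W (\<Theta> \<Omega>), W (\<Theta> \<Omega>)) \<in> c ` S"
      using isCont_eventually[OF cont\<Theta>] sync_branch_covers[OF assms(1-5)] \<Theta>(1)
      by (simp add: \<theta>0_def W_def)
    with \<Theta>(3) show "\<forall>\<^sub>F \<Omega> in nhds \<Omega>0. (\<Theta> \<Omega> / \<Omega>, \<Omega>) \<in> c ` S"
      by eventually_elim simp
    have "isCont (\<lambda>p. (fst p, snd p * fst p)) (\<Omega>0, \<tau>0)"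
      by (intro continuous_intros)
    from isCont_eventually[OF this, of "\<lambda>p. W (snd p) = fst p \<longleftrightarrow> snd p = \<Theta> (fst p)"]
    have "\<forall>\<^sub>F p in nhds (\<Omega>0, \<tau>0). W (snd p * fst p) = fst p \<longleftrightarrow> snd p * fst p = \<Theta> (fst p)"
      using \<Theta>(2) by (simp add: \<theta>0_def)
    moreover have "\<forall>\<^sub>F p in nhds (\<Omega>0, \<tau>0). fst p \<in> - {0}"
      using eventually_nhds_in_open[OF open_vimage_fst[of "- {0}"], of "(\<Omega>0, \<tau>0)"] assms(5) by auto
    ultimately show "\<forall>\<^sub>F p in nhds (\<Omega>0, \<tau>0).
        (snd p, fst p) \<in> sync_set N \<omega> \<kappa> \<longrightarrow> snd p = \<Theta> (fst p) / fst p"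
    proof eventually_elim
      case (elim p)
      then show ?case
        using sync_set_iff[OF assms(1)] by (auto simp: W_def mult.commute field_simps)
    qed
    have "isCont (\<lambda>\<Omega>. \<kappa> * cos (\<Theta> \<Omega>)) \<Omega>0"
      using cont\<Theta> by (intro continuous_intros)
    then have "\<forall>\<^sub>F \<Omega> in nhds \<Omega>0. \<kappa> * cos (\<Theta> \<Omega>) \<in> - {0}"
      by (rule isCont_eventually) (rule eventually_nhds_in_open, use nz \<Theta>(1) in auto)
    with \<Theta>(4) \<Omega>_nz show "\<forall>\<^sub>F \<Omega> in nhds \<Omega>0. ((\<lambda>\<Omega>. \<Theta> \<Omega> / \<Omega>) has_real_derivative
        - (1 + gain \<kappa> (\<Theta> \<Omega> / \<Omega>) \<Omega> * (\<Theta> \<Omega> / \<Omega>)) / (gain \<kappa> (\<Theta> \<Omega> / \<Omega>) \<Omega> * \<Omega>)) (at \<Omega>)"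
    proof eventually_elim
      case (elim \<Omega>)
      then have nz: "\<Omega> \<noteq> 0" "\<kappa> * cos (\<Theta> \<Omega>) \<noteq> 0"
        by auto
      have "((\<lambda>\<Omega>. \<Theta> \<Omega> / \<Omega>) has_real_derivative
          (inverse (- (\<kappa> * cos (\<Theta> \<Omega>))) * \<Omega> - \<Theta> \<Omega> * 1) / (\<Omega> * \<Omega>)) (at \<Omega>)"
        using elim(1) nz(1) by (intro DERIV_divide DERIV_ident)
      moreover have "(inverse (- (\<kappa> * cos (\<Theta> \<Omega>))) * \<Omega> - \<Theta> \<Omega> * 1) / (\<Omega> * \<Omega>) =
          - (1 + gain \<kappa> (\<Theta> \<Omega> / \<Omega>) \<Omega> * (\<Theta> \<Omega> / \<Omega>)) / (gain \<kappa> (\<Theta> \<Omega> / \<Omega>) \<Omega> * \<Omega>)"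
        using nz by (simp add: gain_def field_simps)
      ultimately show ?case
        by simp
    qed
  qed
qed

subsection \<open>The bifurcations\<close>

lemma eventually_nhds_ball:
  assumes "eventually P (nhds x)"
  shows "\<exists>e>0. \<forall>y\<in>ball x e. P y"
  using assms by (auto simp: eventually_nhds_metric dist_commute)

text \<open>Meant for \<open>Y\<close> the branch and \<open>Z\<close> all synchronous solutions:
  inside the box \<open>Z\<close> is the graph, and the graph lies in \<open>Y\<close>, so the
  branch is squeezed in between.\<close>

lemma box_graph_over_fst:
  assumes "Y \<subseteq> Z"
    and "\<forall>x\<in>A. g x \<in> C \<and> (x, g x) \<in> Y \<and> (\<forall>y\<in>C. (x, y) \<in> Z \<longleftrightarrow> y = g x)"
  shows "Z \<inter> (A \<times> C) = (\<lambda>x. (x, g x)) ` A" "Y \<inter> (A \<times> C) = (\<lambda>x. (x, g x)) ` A"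
  using assms by auto

lemma box_graph_over_snd:
  assumes "Y \<subseteq> Z"
    and "\<forall>y\<in>C. h y \<in> A \<and> (h y, y) \<in> Y \<and> (\<forall>x\<in>A. (x, y) \<in> Z \<longleftrightarrow> x = h y)"
  shows "Z \<inter> (A \<times> C) = (\<lambda>y. (h y, y)) ` C" "Y \<inter> (A \<times> C) = (\<lambda>y. (h y, y)) ` C"
  using assms by auto

section \<open>Multiplicity of the zero exponent, and stability for positive gain\<close>

lemma deriv_char_fun_0:
  fixes \<kappa> \<tau> \<Omega> :: real
  assumes "N > 0"
  defines "K \<equiv> gain \<kappa> \<tau> \<Omega>"
  shows "deriv (char_fun N \<kappa> \<tau> \<Omega>) 0 = - of_nat N * of_real (K ^ (N - 1) * (1 + K * \<tau>))"
proof (rule DERIV_imp_deriv)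
  have "(char_fun N \<kappa> \<tau> \<Omega> has_field_derivative
      - (of_nat N * of_real K ^ (N - 1)) - of_real K ^ N * (of_nat N * of_real \<tau>)) (at 0)"
    unfolding char_fun_def K_def by (auto intro!: derivative_eq_intros simp: algebra_simps)
  moreover have "of_real K ^ N = (of_real K * of_real K ^ (N - 1) :: complex)"
    using assms(1) by (cases N) auto
  ultimately show "(char_fun N \<kappa> \<tau> \<Omega> has_field_derivative
      - of_nat N * of_real (K ^ (N - 1) * (1 + K * \<tau>))) (at 0)"
    by (simp add: algebra_simps)
qed

text \<open>The factorization displays the two critical values: \<open>K\<tau> = - 1\<close>, and
  \<open>K = 0\<close> as soon as the power \<open>N - 1\<close> is positive, which is where
  \<open>N \<ge> 2\<close> enters.\<close>

lemma non_simple_zero_char_fun_iff: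
  assumes "N > 0"
  shows "non_simple_zero (char_fun N \<kappa> \<tau> \<Omega>) 0 \<longleftrightarrow>
    gain \<kappa> \<tau> \<Omega> ^ (N - 1) * (1 + gain \<kappa> \<tau> \<Omega> * \<tau>) = 0"
proof -
  have "char_fun N \<kappa> \<tau> \<Omega> 0 = 0"
    by (simp add: char_fun_def)
  then show ?thesis
    unfolding non_simple_zero_def deriv_char_fun_0[OF assms]
    using assms by (simp del: of_real_mult of_real_power of_real_add)
qed

text \<open>For \<open>Re \<mu> \<ge> 0\<close> the delay factor has modulus at most 1, so \<mu>
  lies in the closed disc of radius \<open>K\<close> about \<open>- K\<close>. That disc meets the
  closed right half-plane only in 0.\<close>

lemma sync_stable_if_gain_pos:
  assumes "N > 0" "\<tau> > 0" and K: "gain \<kappa> \<tau> \<Omega> > 0"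
  shows "sync_stable N \<kappa> \<tau> \<Omega>"
proof -
  let ?K = "gain \<kappa> \<tau> \<Omega>"
  have "1 + ?K * \<tau> > 0"
    using assms by (simp add: add_pos_pos)
  then have "\<not> non_simple_zero (char_fun N \<kappa> \<tau> \<Omega>) 0"
    using K by (simp add: non_simple_zero_char_fun_iff[OF assms(1)])
  moreover have "Re \<mu> < 0" if exponent: "\<mu> \<in> char_exponents N \<kappa> \<tau> \<Omega>" and "\<mu> \<noteq> 0" for \<mu>
  proof (rule ccontr)
    assume "\<not> Re \<mu> < 0"
    then have Re: "Re \<mu> \<ge> 0"
      by simp
    obtain n where "\<mu> + of_real ?K = of_real ?K * exp (- \<mu> * of_real \<tau>) * ring_root N n"
      using exponent by (auto simp: char_exponents_def ring_root_def)
    then have "cmod (\<mu> + of_real ?K) = ?K * exp (- (Re \<mu> * \<tau>))"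
      using K by (simp add: norm_mult cmod_ring_root)
    also have "\<dots> \<le> ?K * 1"
      using K Re assms(2) by (intro mult_left_mono) auto
    finally have "(cmod (\<mu> + of_real ?K))\<^sup>2 \<le> ?K\<^sup>2"
      by (intro power_mono) auto
    then have "Re \<mu> * Re \<mu> + 2 * (Re \<mu> * ?K) + Im \<mu> * Im \<mu> \<le> 0"
      unfolding cmod_power2 by (simp add: power2_eq_square algebra_simps)
    moreover have "Re \<mu> * ?K \<ge> 0" "Re \<mu> * Re \<mu> \<ge> 0" "Im \<mu> * Im \<mu> \<ge> 0"
      using Re K by simp_all
    ultimately have "Re \<mu> * Re \<mu> = 0" "Im \<mu> * Im \<mu> = 0"
      by linarith+
    then show False
      using \<open>\<mu> \<noteq> 0\<close> by (simp add: complex_eq_iff)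
  qed
  ultimately show ?thesis
    by (simp add: sync_stable_def)
qed

section \<open>The transcritical bifurcation\<close>

lemma transcritical_bifurcation_at_zero_gain:
  assumes "N \<ge> 2" "\<kappa> > 0" and branch: "sync_branch N \<omega> \<kappa> S c"
    and s0: "s0 \<in> S" "c s0 = (\<tau>0, \<Omega>0)" and zero: "gain \<kappa> \<tau>0 \<Omega>0 = 0"
  shows "transcritical_bifurcation N \<omega> \<kappa> (c ` S) \<tau>0 \<Omega>0"
proof -
  have N: "N > 0"
    using assms(1) by simp
  have sub: "c ` S \<subseteq> sync_set N \<omega> \<kappa>"
    using branch by (simp add: sync_branch_def)
  then have "(\<tau>0, \<Omega>0) \<in> sync_set N \<omega> \<kappa>"
    using s0 by force
  then have \<tau>0: "\<tau>0 > 0"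
    using sync_set_iff[OF N] by simp
  have \<Omega>0: "\<Omega>0 \<noteq> 0"
    using zero assms(2) by (auto simp: gain_def)
  have cos0: "cos (\<Omega>0 * \<tau>0) = 0"
    using zero assms(2) by (simp add: gain_def)
  obtain g where g: "g \<tau>0 = \<Omega>0" "\<forall>\<^sub>F \<tau> in nhds \<tau>0. isCont g \<tau>"
    "\<forall>\<^sub>F \<tau> in nhds \<tau>0. (\<tau>, g \<tau>) \<in> c ` S"
    "\<forall>\<^sub>F p in nhds (\<tau>0, \<Omega>0). (fst p, snd p) \<in> sync_set N \<omega> \<kappa> \<longrightarrow> snd p = g (fst p)"
    "(g has_real_derivative 0) (at \<tau>0)"
    by (rule sync_curve_over_delay[OF N branch s0 \<Omega>0 zero])
  \<comment> \<open>The speed of the gain along the branch: as \<open>g' = 0\<close> at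
    \<open>\<tau>0\<close>, the phase \<Omega> \<tau> moves with speed \<open>\<Omega>0\<close>. It
    is nonzero since the sine is nonzero where the cosine vanishes.\<close>
  define D where "D = - \<kappa> * sin (\<Omega>0 * \<tau>0) * \<Omega>0"
  have "sin (\<Omega>0 * \<tau>0) \<noteq> 0"
    using cos0 sin_cos_squared_add[of "\<Omega>0 * \<tau>0"] by auto
  then have D: "D \<noteq> 0"
    using assms(2) \<Omega>0 by (simp add: D_def)
  have dK: "((\<lambda>\<tau>. gain \<kappa> \<tau> (g \<tau>)) has_real_derivative D) (at \<tau>0)"
    unfolding gain_def D_def by (auto intro!: derivative_eq_intros g(5) simp: g(1))
  have K0: "gain \<kappa> \<tau>0 (g \<tau>0) = 0"
    by (simp add: g(1) zero)
  obtain \<mu> where \<mu>: "exponents_through_zero N \<kappa> (\<lambda>\<tau>. (\<tau>, g \<tau>)) \<tau>0 (N - 1) \<mu>"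
    and d\<mu>: "\<And>i. i < N - 1 \<Longrightarrow> \<exists>v. (\<mu> i has_vector_derivative v) (at \<tau>0) \<and> Re v * D < 0"
    using exponents_at_zero_gain[where g = g and \<kappa> = \<kappa>, OF assms(1) \<tau>0 g(2) K0 dK D] by blast
  obtain r where r: "r > 0" "\<forall>\<^sub>F \<tau> in nhds \<tau>0. g \<tau> \<in> ball \<Omega>0 r \<and>
      (\<forall>\<Omega>\<in>ball \<Omega>0 r. (\<tau>, \<Omega>) \<in> sync_set N \<omega> \<kappa> \<longleftrightarrow> \<Omega> = g \<tau>)"
  proof (rule local_graph[of "\<lambda>\<tau> \<Omega>. (\<tau>, \<Omega>) \<in> sync_set N \<omega> \<kappa>" g \<tau>0, unfolded g(1)])
    show "\<forall>\<^sub>F \<tau> in nhds \<tau>0. (\<tau>, g \<tau>) \<in> sync_set N \<omega> \<kappa>"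
      using g(3) by eventually_elim (use sub in blast)
    show "\<forall>\<^sub>F p in nhds (\<tau>0, \<Omega>0). (fst p, snd p) \<in> sync_set N \<omega> \<kappa> \<longrightarrow> snd p = g (fst p)"
      by (rule g(4))
    show "isCont g \<tau>0"
      using g(5) by (rule DERIV_isCont)
  qed
  obtain v where v: "(\<mu> 0 has_vector_derivative v) (at \<tau>0)" "Re v * D < 0"
    using d\<mu>[of 0] assms(1) by auto
  have \<mu>0: "\<mu> 0 \<tau>0 = 0"
    using \<mu> assms(1) by (auto simp: exponents_through_zero_def)
  have "\<forall>\<^sub>F \<tau> in at \<tau>0. Re v * (\<tau> - \<tau>0) * Re (\<mu> 0 \<tau>) > 0"
    using v(2) by (intro eventually_Re_sign v(1) \<mu>0) auto
  moreover have "\<forall>\<^sub>F \<tau> in at \<tau>0. D * (\<tau> - \<tau>0) * gain \<kappa> \<tau> (g \<tau>) > 0"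
    using dK K0 D by (rule DERIV_eventually_sign)
  moreover have "\<forall>\<^sub>F \<tau> in at \<tau>0. \<mu> 0 \<tau> \<in> char_exponents N \<kappa> \<tau> (g \<tau>)"
    using exponents_through_zero_mem[OF \<mu>, of 0] assms(1)
    by (simp add: eventually_at_filter eventually_mono)
  moreover have "\<forall>\<^sub>F \<tau> in at \<tau>0. \<tau> \<in> {0<..}"
    using \<tau>0 eventually_nhds_in_open[OF open_greaterThan[of 0], of \<tau>0]
    by (simp add: eventually_at_filter eventually_mono)
  \<comment> \<open>On the side of positive gain stability follows from the disc estimate; on the
    other side the single exponent \<open>\<mu> 0\<close>, which moves against the gain, already has
    positive real part.\<close>
  ultimately have stability: "\<forall>\<^sub>F \<tau> in at \<tau>0.
      (D * (\<tau> - \<tau>0) > 0 \<longrightarrow> sync_stable N \<kappa> \<tau> (g \<tau>)) \<and>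
      (D * (\<tau> - \<tau>0) < 0 \<longrightarrow> sync_unstable N \<kappa> \<tau> (g \<tau>))"
  proof eventually_elim
    case (elim \<tau>)
    have "sync_stable N \<kappa> \<tau> (g \<tau>)" if "D * (\<tau> - \<tau>0) > 0"
      using zero_less_mult_pos[OF elim(2) that] elim(4) N by (intro sync_stable_if_gain_pos) auto
    moreover have "Re (\<mu> 0 \<tau>) > 0" if "D * (\<tau> - \<tau>0) < 0"
    proof -
      have "0 < D * D * (Re v * (\<tau> - \<tau>0))"
        using mult_neg_neg[OF v(2) that] by (simp add: mult_ac)
      moreover have "0 < D * D"
        using D by (auto simp: zero_less_mult_iff)
      ultimately show ?thesis
        using elim(1) zero_less_mult_pos by blast
    qed
    ultimately show ?case
      using elim(3) by (auto simp: sync_unstable_def)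
  qed
  \<comment> \<open>All local facts are merged into one eventual statement, so that a single
    \<epsilon> serves the graph, the branch and the stability exchange.\<close>
  from r(2) g(2,3) stability[unfolded eventually_at_filter]
  have "\<forall>\<^sub>F \<tau> in nhds \<tau>0. (g \<tau> \<in> ball \<Omega>0 r \<and>
      (\<forall>\<Omega>\<in>ball \<Omega>0 r. (\<tau>, \<Omega>) \<in> sync_set N \<omega> \<kappa> \<longleftrightarrow> \<Omega> = g \<tau>)) \<and> isCont g \<tau> \<and> (\<tau>, g \<tau>) \<in> c ` S \<and>
      (D * (\<tau> - \<tau>0) > 0 \<longrightarrow> sync_stable N \<kappa> \<tau> (g \<tau>)) \<and>
      (D * (\<tau> - \<tau>0) < 0 \<longrightarrow> sync_unstable N \<kappa> \<tau> (g \<tau>))"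
    (is "eventually ?P _")
    by eventually_elim auto
  from eventually_nhds_ball[OF this]
  obtain \<epsilon> where "\<epsilon> > 0" and P: "\<forall>\<tau>\<in>ball \<tau>0 \<epsilon>. ?P \<tau>"
    by (elim exE conjE) (rule that)
  have \<epsilon>: "\<epsilon> > 0" "\<And>\<tau>. \<tau> \<in> ball \<tau>0 \<epsilon> \<Longrightarrow> g \<tau> \<in> ball \<Omega>0 r"
    "\<And>\<tau> \<Omega>. \<tau> \<in> ball \<tau>0 \<epsilon> \<Longrightarrow> \<Omega> \<in> ball \<Omega>0 r \<Longrightarrow> (\<tau>, \<Omega>) \<in> sync_set N \<omega> \<kappa> \<longleftrightarrow> \<Omega> = g \<tau>"
    "\<And>\<tau>. \<tau> \<in> ball \<tau>0 \<epsilon> \<Longrightarrow> isCont g \<tau>"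
    "\<And>\<tau>. \<tau> \<in> ball \<tau>0 \<epsilon> \<Longrightarrow> (\<tau>, g \<tau>) \<in> c ` S"
    "\<And>\<tau>. \<tau> \<in> ball \<tau>0 \<epsilon> \<Longrightarrow> D * (\<tau> - \<tau>0) > 0 \<Longrightarrow> sync_stable N \<kappa> \<tau> (g \<tau>)"
    "\<And>\<tau>. \<tau> \<in> ball \<tau>0 \<epsilon> \<Longrightarrow> D * (\<tau> - \<tau>0) < 0 \<Longrightarrow> sync_unstable N \<kappa> \<tau> (g \<tau>)"
    using \<open>\<epsilon> > 0\<close> P[rule_format] by (auto simp del: mem_ball)
  have "\<forall>\<tau>\<in>ball \<tau>0 \<epsilon>. g \<tau> \<in> ball \<Omega>0 r \<and> (\<tau>, g \<tau>) \<in> c ` S \<and>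
      (\<forall>\<Omega>\<in>ball \<Omega>0 r. (\<tau>, \<Omega>) \<in> sync_set N \<omega> \<kappa> \<longleftrightarrow> \<Omega> = g \<tau>)"
    by (intro ballI conjI \<epsilon>)
  note boxes = box_graph_over_fst[OF sub this]
  have cont: "continuous_on (ball \<tau>0 \<epsilon>) g"
    using \<epsilon>(4) by (simp add: continuous_at_imp_continuous_on)
  have speed: "\<exists>m \<mu>. exponents_through_zero N \<kappa> (\<lambda>\<tau>. (\<tau>, g \<tau>)) \<tau>0 m \<mu> \<and>
      (\<forall>i<m. \<exists>v. (\<mu> i has_vector_derivative v) (at \<tau>0) \<and> Re v \<noteq> 0)"
    using \<mu> d\<mu> by (intro exI[of _ "N - 1"] exI[of _ \<mu>]) fastforce
  have exchange: "(\<forall>\<tau>\<in>{\<tau>0 - \<epsilon><..<\<tau>0}. sync_stable N \<kappa> \<tau> (g \<tau>)) \<and>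
         (\<forall>\<tau>\<in>{\<tau>0<..<\<tau>0 + \<epsilon>}. sync_unstable N \<kappa> \<tau> (g \<tau>)) \<or>
         (\<forall>\<tau>\<in>{\<tau>0 - \<epsilon><..<\<tau>0}. sync_unstable N \<kappa> \<tau> (g \<tau>)) \<and>
         (\<forall>\<tau>\<in>{\<tau>0<..<\<tau>0 + \<epsilon>}. sync_stable N \<kappa> \<tau> (g \<tau>))"
  proof (cases "D > 0")
    case True
    then show ?thesis
      using \<epsilon>(6,7) by (intro disjI2) (auto simp: dist_real_def mult_less_0_iff)
  next
    case False
    then have "D < 0"
      using D by simp
    then show ?thesis
      using \<epsilon>(6,7) by (intro disjI1) (auto simp: dist_real_def zero_less_mult_iff mult_less_0_iff)
  qed
  have non_simple: "non_simple_zero (char_fun N \<kappa> \<tau>0 \<Omega>0) 0"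
    using assms(1) by (simp add: non_simple_zero_char_fun_iff[OF N] zero)
  show ?thesis
    unfolding transcritical_bifurcation_def
    by (rule conjI[OF non_simple], rule exI[of _ \<epsilon>], rule conjI[OF \<epsilon>(1)],
        rule exI[of _ r], rule conjI[OF r(1)], rule exI[of _ g], intro conjI)
      (fact g(1) cont boxes speed exchange)+
qed

section \<open>The fold bifurcation\<close>

lemma two_solutions_emergeI:
  assumes "N > 0" and e: "e > 0" and r: "r > 0" and h0: "h \<Omega>0 = \<tau>0"
    and graph: "\<And>\<Omega> \<tau>. \<Omega> \<in> ball \<Omega>0 e \<Longrightarrow> \<tau> \<in> ball \<tau>0 r \<Longrightarrow> (\<tau>, \<Omega>) \<in> sync_set N \<omega> \<kappa> \<longleftrightarrow> \<tau> = h \<Omega>"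
    and deriv: "\<And>\<Omega>. \<Omega> \<in> ball \<Omega>0 e \<Longrightarrow> (h has_real_derivative h' \<Omega>) (at \<Omega>)"
    and sign: "\<And>\<Omega>. \<Omega> \<in> ball \<Omega>0 e \<Longrightarrow> \<Omega> \<noteq> \<Omega>0 \<Longrightarrow> a * (\<Omega> - \<Omega>0) * h' \<Omega> > 0"
  shows "two_solutions_emerge N \<omega> \<kappa> \<tau>0 \<Omega>0"
proof -
  \<comment> \<open>The sign turns both kinds of fold into a strict minimum of \<open>H\<close> with
    value 0: the solutions at \<open>\<tau>0 + \<sigma> * d\<close> are the roots of
    \<open>H \<Omega> = d\<close>.\<close>
  define \<sigma> :: real where "\<sigma> = (if a > 0 then 1 else - 1)"
  have \<sigma>: "\<sigma> \<in> {1, - 1}"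
    by (simp add: \<sigma>_def)
  define H where "H \<Omega> = \<sigma> * (h \<Omega> - \<tau>0)" for \<Omega>
  have H_iff: "h \<Omega> = \<tau>0 + \<sigma> * d \<longleftrightarrow> H \<Omega> = d" for \<Omega> d
    using \<sigma> by (auto simp: H_def)
  obtain e0 \<Omega>1 \<Omega>2 where e0: "e0 > 0"
    and lim: "(\<Omega>1 \<longlongrightarrow> \<Omega>0) (at_right 0)" "(\<Omega>2 \<longlongrightarrow> \<Omega>0) (at_right 0)"
    and roots: "\<And>d. 0 < d \<Longrightarrow> d < e0 \<Longrightarrow>
      {\<Omega> \<in> ball \<Omega>0 e. H \<Omega> = d} = {\<Omega>1 d, \<Omega>2 d} \<and> \<Omega>1 d < \<Omega>0 \<and> \<Omega>0 < \<Omega>2 d"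
    and pos: "\<And>\<Omega>. \<Omega> \<in> ball \<Omega>0 e \<Longrightarrow> \<Omega> \<noteq> \<Omega>0 \<Longrightarrow> H \<Omega> > 0"
  proof (rule strict_minimum_two_roots[of e H \<Omega>0 "\<lambda>\<Omega>. \<sigma> * h' \<Omega>"])
    show "H \<Omega>0 = 0"
      by (simp add: H_def h0)
    show "(H has_real_derivative \<sigma> * h' \<Omega>) (at \<Omega>)" if "\<Omega> \<in> ball \<Omega>0 e" for \<Omega>
      unfolding H_def using that by (auto intro!: derivative_eq_intros deriv)
    show "(\<Omega> - \<Omega>0) * (\<sigma> * h' \<Omega>) > 0" if "\<Omega> \<in> ball \<Omega>0 e" "\<Omega> \<noteq> \<Omega>0" for \<Omega>
      using sign[OF that] by (auto simp: \<sigma>_def zero_less_mult_iff mult_less_0_iff split: if_splits)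
  qed (use e in auto)
  have H0: "H \<Omega>0 = 0"
    by (simp add: H_def h0)
  \<comment> \<open>Used for zero, positive and negative \<open>d\<close>: one, two and no roots.
    The bound on \<open>d\<close> keeps the delay in the box where the solutions form the graph of
    \<open>h\<close>.\<close>
  have slice: "{\<Omega> \<in> ball \<Omega>0 e. (\<tau>0 + \<sigma> * d, \<Omega>) \<in> sync_set N \<omega> \<kappa>} = {\<Omega> \<in> ball \<Omega>0 e. H \<Omega> = d}"
    if "\<bar>d\<bar> < r" for d
  proof -
    have "\<tau>0 + \<sigma> * d \<in> ball \<tau>0 r"
      using that \<sigma> by (auto simp: dist_real_def)
    then show ?thesis
      using graph H_iff by (metis (mono_tags, lifting))
  qed
  show ?thesis
    unfolding two_solutions_emerge_def
  proof (rule bexI[OF _ \<sigma>], rule exI[of _ "min e0 r"], rule conjI, simp add: e0 r,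
      rule exI[of _ e], rule conjI[OF e], rule exI[of _ \<Omega>1], rule exI[of _ \<Omega>2], intro conjI ballI)
    show "{\<Omega> \<in> ball \<Omega>0 e. (\<tau>0, \<Omega>) \<in> sync_set N \<omega> \<kappa>} = {\<Omega>0}"
      using slice[of 0] r e H0 pos by fastforce
  next
    fix d assume "d \<in> {0<..<min e0 r}"
    then have d: "0 < d" "d < e0" "d < r"
      by auto
    show "{\<Omega> \<in> ball \<Omega>0 e. (\<tau>0 + \<sigma> * d, \<Omega>) \<in> sync_set N \<omega> \<kappa>} = {\<Omega>1 d, \<Omega>2 d}"
      "\<Omega>1 d < \<Omega>0" "\<Omega>0 < \<Omega>2 d"
      using slice[of d] roots[of d] d by simp_all
    show "{\<Omega> \<in> ball \<Omega>0 e. (\<tau>0 - \<sigma> * d, \<Omega>) \<in> sync_set N \<omega> \<kappa>} = {}"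
      using slice[of "- d"] pos H0 d by fastforce
  qed (fact lim)+
qed

lemma fold_bifurcation_at_critical_gain:
  assumes "N \<ge> 2" "\<kappa> > 0" and branch: "sync_branch N \<omega> \<kappa> S c"
    and s0: "s0 \<in> S" "c s0 = (\<tau>0, \<Omega>0)" and gain0: "gain \<kappa> \<tau>0 \<Omega>0 = - 1 / \<tau>0"
    and nonresonant: "\<And>l::int. odd l \<Longrightarrow> \<omega> \<noteq> pi * of_int l * \<kappa>"
  shows "fold_bifurcation N \<omega> \<kappa> (c ` S) \<tau>0 \<Omega>0"
proof -
  have N: "N > 0"
    using assms(1) by simp
  have sub: "c ` S \<subseteq> sync_set N \<omega> \<kappa>"
    using branch by (simp add: sync_branch_def)
  then have "(\<tau>0, \<Omega>0) \<in> sync_set N \<omega> \<kappa>"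
    using s0 by force
  from iffD1[OF sync_set_iff[OF N] this]
  have \<tau>0: "\<tau>0 > 0" and eq0: "\<Omega>0 = \<omega> - \<kappa> * sin (\<Omega>0 * \<tau>0)"
    by auto
  have neg: "gain \<kappa> \<tau>0 \<Omega>0 < 0"
    using gain0 \<tau>0 by simp
  have \<Omega>0: "\<Omega>0 \<noteq> 0"
    using neg assms(2) by (auto simp: gain_def)
  \<comment> \<open>Otherwise \<theta> is a multiple \<open>l\<close> of \<pi>; negative gain makes
    \<open>l\<close> odd, so the cosine is - 1 and \<open>\<kappa> * \<tau>0 = 1\<close>. As
    \<open>\<omega> = \<Omega>0\<close> in this case, \<omega> would equal
    \<open>pi * l * \<kappa>\<close>.\<close>
  have sin0: "sin (\<Omega>0 * \<tau>0) \<noteq> 0"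
  proof
    assume sin: "sin (\<Omega>0 * \<tau>0) = 0"
    then obtain l :: int where l: "\<Omega>0 * \<tau>0 = of_int l * pi"
      using sin_zero_iff_int2 by blast
    then have cos: "cos (\<Omega>0 * \<tau>0) = (if even l then 1 else - 1)"
      using cos_npi_int[of l] by (simp add: mult.commute)
    then have "odd l"
      using neg assms(2) by (auto simp: gain_def split: if_splits)
    then have "\<kappa> * \<tau>0 = 1"
      using gain0 cos \<tau>0 by (simp add: gain_def field_simps)
    then have "\<omega> = \<Omega>0 * (\<kappa> * \<tau>0)"
      using eq0 sin by simp
    also have "\<dots> = pi * of_int l * \<kappa>"
      using l by (simp add: mult_ac)
    finally show False
      using nonresonant \<open>odd l\<close> by blast
  qed
  obtain h where h: "h \<Omega>0 = \<tau>0" "\<forall>\<^sub>F \<Omega> in nhds \<Omega>0. (h \<Omega>, \<Omega>) \<in> c ` S"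
    "\<forall>\<^sub>F p in nhds (\<Omega>0, \<tau>0). (snd p, fst p) \<in> sync_set N \<omega> \<kappa> \<longrightarrow> snd p = h (fst p)"
    "\<forall>\<^sub>F \<Omega> in nhds \<Omega>0. (h has_real_derivative
      - (1 + gain \<kappa> (h \<Omega>) \<Omega> * h \<Omega>) / (gain \<kappa> (h \<Omega>) \<Omega> * \<Omega>)) (at \<Omega>)"
    by (rule sync_curve_over_frequency[OF N branch s0 \<Omega>0 less_imp_neq[OF neg]])
  define h' where "h' \<Omega> = - (1 + gain \<kappa> (h \<Omega>) \<Omega> * h \<Omega>) / (gain \<kappa> (h \<Omega>) \<Omega> * \<Omega>)" for \<Omega>
  note dh = h(4)[folded h'_def]
  have crit: "gain \<kappa> (h \<Omega>0) \<Omega>0 * h \<Omega>0 = - 1"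
    using gain0 \<tau>0 by (simp add: h(1))
  have h'0: "h' \<Omega>0 = 0"
    by (simp add: h'_def crit)
  have dh0: "(h has_real_derivative 0) (at \<Omega>0)"
    using eventually_nhds_x_imp_x[OF dh] h'0 by simp
  have dK: "((\<lambda>\<Omega>. gain \<kappa> (h \<Omega>) \<Omega>) has_real_derivative - \<kappa> * sin (\<Omega>0 * \<tau>0) * \<tau>0) (at \<Omega>0)"
    unfolding gain_def by (auto intro!: derivative_eq_intros dh0 simp: h(1))
  \<comment> \<open>The derivative of \<open>K\<tau>\<close> in \<Omega>. Since
    \<open>h' = 0\<close> at the point, the delay is stationary and only the explicit \<Omega> in
    the cosine contributes.\<close>
  define D where "D = - \<kappa> * sin (\<Omega>0 * \<tau>0) * \<tau>0 * \<tau>0"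
  have D: "D \<noteq> 0"
    using assms(2) sin0 \<tau>0 by (simp add: D_def)
  have dk: "((\<lambda>\<Omega>. gain \<kappa> (h \<Omega>) \<Omega> * h \<Omega>) has_real_derivative D) (at \<Omega>0)"
    unfolding D_def by (auto intro!: derivative_eq_intros dK dh0 simp: h(1))
  \<comment> \<open>The value of \<open>h''\<close>: the numerator \<open>1 + K\<tau>\<close> of
    \<open>h'\<close> vanishes at the point, so the quotient rule leaves
    \<open>- D / (K * \<Omega>0)\<close> with \<open>K = - 1 / \<tau>0\<close>.\<close>
  define a where "a = D * \<tau>0 / \<Omega>0"
  have a: "a \<noteq> 0"
    using D \<tau>0 \<Omega>0 by (simp add: a_def)
  have dh': "(h' has_real_derivative a) (at \<Omega>0)"
  proof -
    have den: "gain \<kappa> (h \<Omega>0) \<Omega>0 * \<Omega>0 \<noteq> 0"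
      using neg \<Omega>0 by (simp add: h(1))
    have num: "((\<lambda>\<Omega>. - (1 + gain \<kappa> (h \<Omega>) \<Omega> * h \<Omega>)) has_real_derivative - D) (at \<Omega>0)"
      using DERIV_minus[OF DERIV_add[OF DERIV_const dk, of 1]] by simp
    have denom: "((\<lambda>\<Omega>. gain \<kappa> (h \<Omega>) \<Omega> * \<Omega>) has_real_derivative
        - \<kappa> * sin (\<Omega>0 * \<tau>0) * \<tau>0 * \<Omega>0 + 1 * gain \<kappa> (h \<Omega>0) \<Omega>0) (at \<Omega>0)"
      by (rule DERIV_mult[OF dK DERIV_ident])
    have "(h' has_real_derivative - D / (gain \<kappa> (h \<Omega>0) \<Omega>0 * \<Omega>0)) (at \<Omega>0)"
      unfolding h'_def using DERIV_divide[OF num denom den] crit den by simp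
    moreover have "- D / (gain \<kappa> (h \<Omega>0) \<Omega>0 * \<Omega>0) = a"
      using \<tau>0 \<Omega>0 by (simp add: a_def h(1) gain0)
    ultimately show ?thesis
      by simp
  qed
  have sign: "\<forall>\<^sub>F \<Omega> in at \<Omega>0. a * (\<Omega> - \<Omega>0) * h' \<Omega> > 0"
    using dh' h'0 a by (rule DERIV_eventually_sign)
  have conth: "\<forall>\<^sub>F \<Omega> in nhds \<Omega>0. isCont h \<Omega>"
    using dh by eventually_elim (rule DERIV_isCont)
  have h0pos: "h \<Omega>0 > 0"
    using \<tau>0 by (simp add: h(1))
  obtain \<mu> where \<mu>: "exponents_through_zero N \<kappa> (\<lambda>\<Omega>. (h \<Omega>, \<Omega>)) \<Omega>0 1 \<mu>"
    "\<exists>v. (\<mu> 0 has_vector_derivative v) (at \<Omega>0) \<and> Re v \<noteq> 0"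
    using exponents_at_fold[where h = h and \<kappa> = \<kappa>, OF assms(1) h0pos conth dh0 crit dk D] by blast
  obtain v where v: "(\<mu> 0 has_vector_derivative v) (at \<Omega>0)" "Re v \<noteq> 0"
    using \<mu>(2) by blast
  have "\<mu> 0 \<Omega>0 = 0"
    using \<mu>(1) by (auto simp: exponents_through_zero_def)
  with v have "\<forall>\<^sub>F \<Omega> in at \<Omega>0. Re v * (\<Omega> - \<Omega>0) * Re (\<mu> 0 \<Omega>) > 0"
    by (intro eventually_Re_sign)
  then have "\<forall>\<^sub>F \<Omega> in at \<Omega>0. (if Re v > 0 then 1 else - 1) * (\<Omega> - \<Omega>0) * Re (\<mu> 0 \<Omega>) > 0"
    by eventually_elim (auto simp: zero_less_mult_iff mult_less_0_iff split: if_splits)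
  then have "\<exists>\<sigma>\<in>{1, - 1 :: real}. \<forall>\<^sub>F \<Omega> in at \<Omega>0. \<sigma> * (\<Omega> - \<Omega>0) * Re (\<mu> 0 \<Omega>) > 0"
    by (intro bexI[of _ "if Re v > 0 then 1 else - 1"]) auto
  with \<mu>(1) have cross: "\<exists>m \<mu>. exponents_through_zero N \<kappa> (\<lambda>\<Omega>. (h \<Omega>, \<Omega>)) \<Omega>0 m \<mu> \<and>
      (\<forall>i<m. \<exists>\<sigma>\<in>{1, - 1}. \<forall>\<^sub>F \<Omega> in at \<Omega>0. \<sigma> * (\<Omega> - \<Omega>0) * Re (\<mu> i \<Omega>) > 0)"
    by (intro exI[of _ 1] exI[of _ \<mu>]) auto
  obtain r where r: "r > 0" "\<forall>\<^sub>F \<Omega> in nhds \<Omega>0. h \<Omega> \<in> ball \<tau>0 r \<and>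
      (\<forall>\<tau>\<in>ball \<tau>0 r. (\<tau>, \<Omega>) \<in> sync_set N \<omega> \<kappa> \<longleftrightarrow> \<tau> = h \<Omega>)"
  proof (rule local_graph[of "\<lambda>\<Omega> \<tau>. (\<tau>, \<Omega>) \<in> sync_set N \<omega> \<kappa>" h \<Omega>0, unfolded h(1)])
    show "\<forall>\<^sub>F \<Omega> in nhds \<Omega>0. (h \<Omega>, \<Omega>) \<in> sync_set N \<omega> \<kappa>"
      using h(2) by eventually_elim (use sub in blast)
    show "\<forall>\<^sub>F p in nhds (\<Omega>0, \<tau>0). (snd p, fst p) \<in> sync_set N \<omega> \<kappa> \<longrightarrow> snd p = h (fst p)"
      by (rule h(3))
    show "isCont h \<Omega>0"
      using dh0 by (rule DERIV_isCont)
  qed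
  from r(2) h(2) dh sign[unfolded eventually_at_filter]
  have "\<forall>\<^sub>F \<Omega> in nhds \<Omega>0. (h \<Omega> \<in> ball \<tau>0 r \<and>
      (\<forall>\<tau>\<in>ball \<tau>0 r. (\<tau>, \<Omega>) \<in> sync_set N \<omega> \<kappa> \<longleftrightarrow> \<tau> = h \<Omega>)) \<and> (h \<Omega>, \<Omega>) \<in> c ` S \<and>
      (h has_real_derivative h' \<Omega>) (at \<Omega>) \<and> (\<Omega> \<noteq> \<Omega>0 \<longrightarrow> a * (\<Omega> - \<Omega>0) * h' \<Omega> > 0)"
    (is "eventually ?P _")
    by eventually_elim auto
  from eventually_nhds_ball[OF this]
  obtain e where "e > 0" and P: "\<forall>\<Omega>\<in>ball \<Omega>0 e. ?P \<Omega>"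
    by (elim exE conjE) (rule that)
  have e: "e > 0" "\<And>\<Omega>. \<Omega> \<in> ball \<Omega>0 e \<Longrightarrow> h \<Omega> \<in> ball \<tau>0 r"
    "\<And>\<Omega> \<tau>. \<Omega> \<in> ball \<Omega>0 e \<Longrightarrow> \<tau> \<in> ball \<tau>0 r \<Longrightarrow> (\<tau>, \<Omega>) \<in> sync_set N \<omega> \<kappa> \<longleftrightarrow> \<tau> = h \<Omega>"
    "\<And>\<Omega>. \<Omega> \<in> ball \<Omega>0 e \<Longrightarrow> (h \<Omega>, \<Omega>) \<in> c ` S"
    "\<And>\<Omega>. \<Omega> \<in> ball \<Omega>0 e \<Longrightarrow> (h has_real_derivative h' \<Omega>) (at \<Omega>)"
    "\<And>\<Omega>. \<Omega> \<in> ball \<Omega>0 e \<Longrightarrow> \<Omega> \<noteq> \<Omega>0 \<Longrightarrow> a * (\<Omega> - \<Omega>0) * h' \<Omega> > 0"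
    using \<open>e > 0\<close> P[rule_format] by (auto simp del: mem_ball)
  have "\<forall>\<Omega>\<in>ball \<Omega>0 e. h \<Omega> \<in> ball \<tau>0 r \<and> (h \<Omega>, \<Omega>) \<in> c ` S \<and>
      (\<forall>\<tau>\<in>ball \<tau>0 r. (\<tau>, \<Omega>) \<in> sync_set N \<omega> \<kappa> \<longleftrightarrow> \<tau> = h \<Omega>)"
    by (intro ballI conjI e)
  note boxes = box_graph_over_snd[OF sub this]
  have emerge: "two_solutions_emerge N \<omega> \<kappa> \<tau>0 \<Omega>0"
    using N e(1) r(1) h(1) e(3,5,6) by (rule two_solutions_emergeI)
  have non_simple: "non_simple_zero (char_fun N \<kappa> \<tau>0 \<Omega>0) 0"
    using crit by (simp add: non_simple_zero_char_fun_iff[OF N] h(1))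
  show ?thesis
    unfolding fold_bifurcation_def
    by (rule conjI[OF non_simple], rule conjI[OF emerge], rule exI[of _ r], rule conjI[OF r(1)],
        rule exI[of _ e], rule conjI[OF e(1)], rule exI[of _ h], rule exI[of _ h'], rule exI[of _ a],
        intro conjI ballI)
      (erule e(5) | fact h(1) boxes h'0 dh' a cross)+
qed

theorem lemma3:
  fixes N :: nat and \<omega> \<kappa> :: real
    and S :: "real set" and c :: "real \<Rightarrow> real \<times> real" and s0 \<tau>0 \<Omega>0 :: real
  assumes "N \<ge> 2" and "\<kappa> > 0"
    and "sync_branch N \<omega> \<kappa> S c"
    and "s0 \<in> S" and "c s0 = (\<tau>0, \<Omega>0)"
  shows "(gain \<kappa> \<tau>0 \<Omega>0 = 0 \<longrightarrow> transcritical_bifurcation N \<omega> \<kappa> (c ` S) \<tau>0 \<Omega>0) \<and>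
         ((\<forall>l::int. odd l \<longrightarrow> \<omega> \<noteq> pi * of_int l * \<kappa>) \<longrightarrow>
           gain \<kappa> \<tau>0 \<Omega>0 = - 1 / \<tau>0 \<longrightarrow> fold_bifurcation N \<omega> \<kappa> (c ` S) \<tau>0 \<Omega>0)"
  using transcritical_bifurcation_at_zero_gain[OF assms] fold_bifurcation_at_critical_gain[OF assms]
  by blast

end
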